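(* There is a constant $n_0>0$ such that the following holds for all $n\geq n_0$ and all $p=p(n)$ with $0<p\leq 0.99$. Let $m$ be a median of $\vartheta(G(n,p))$, i.e. $\Pr(\vartheta(G(n,p))\leq m)\geq 1/2$ and $\Pr(\vartheta(G(n,p))\geq m)\geq 1/2$. (i) For every $\xi\geq\max\{10,m^{1/2}\}$: $\Pr(\vartheta(G(n,p))\geq m+\xi)\leq 30\exp(-\xi^2/(5m+10\xi))$. (ii) For every $\xi>10$: $\Pr(\vartheta(G(n,p))\leq m-\xi)\leq 3\exp(-\xi^2/(10m))$. The same statements hold with $\vartheta$ replaced by $\vartheta_{1/2}$ (with $m$ then a median of $\vartheta_{1/2}(G(n,p))$) or by $\vartheta_2$ (with $m$ a median of $\vartheta_2(G(n,p))$).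
   Context: $G(n,p)$ is the random graph on vertex set $V=\{1,\dots,n\}$ in which each of the $\binom n2$ possible edges is present independently with probability $p$. For a graph $G=(V,E)$ with $V=\{1,\dots,n\}$ and a real $k>1$, an $n$-tuple $(v_1,\dots,v_n)$ of unit vectors in $\mathbb R^n$ is a vector $k$-coloring if $\langle v_i,v_j\rangle\leq -1/(k-1)$ for all $\{i,j\}\in E$; it is strict if $\langle v_i,v_j\rangle=-1/(k-1)$ for all $\{i,j\}\in E$; it is rigid if $\langle v_i,v_j\rangle=-1/(k-1)$ for all $\{i,j\}\in E$ and $\langle v_i,v_j\rangle\geq -1/(k-1)$ for all $\{i,j\}\notin E$ ($i\neq j$). Let $\bar\vartheta_{1/2}(G)$, $\bar\vartheta(G)$, $\bar\vartheta_2(G)$ be the infimum of $k>1$ such that $G$ admits a vector, strict vector, resp. rigid vector $k$-coloring. For the complement $\bar G$ of $G$ set $\vartheta_{1/2}(G)=\bar\vartheta_{1/2}(\bar G)$, $\vartheta(G)=\bar\vartheta(\bar G)$ (the Lovász number), $\vartheta_2(G)=\bar\vartheta_2(\bar G)$. *)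

theory Defs
  imports Complex_Main
begin

text \<open>Vertex set {0..<n} (a relabelling of {1..n}). A graph on it is a set E of
  2-element subsets of the vertex set. Vectors of R^n are functions nat => real,
  of which only the coordinates l < n are used.\<close>

definition all_pairs :: "nat \<Rightarrow> nat set set" where
  "all_pairs n = {{i, j} | i j. i < n \<and> j < n \<and> i \<noteq> j}"

definition ip :: "nat \<Rightarrow> (nat \<Rightarrow> real) \<Rightarrow> (nat \<Rightarrow> real) \<Rightarrow> real" where
  "ip n x y = (\<Sum>l<n. x l * y l)"

definition unit_vecs :: "nat \<Rightarrow> (nat \<Rightarrow> nat \<Rightarrow> real) \<Rightarrow> bool" where
  "unit_vecs n v \<longleftrightarrow> (\<forall>i<n. ip n (v i) (v i) = 1)"

definition vector_coloring :: "nat \<Rightarrow> nat set set \<Rightarrow> real \<Rightarrow> (nat \<Rightarrow> nat \<Rightarrow> real) \<Rightarrow> bool" where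
  "vector_coloring n E k v \<longleftrightarrow> unit_vecs n v \<and>
     (\<forall>i<n. \<forall>j<n. i \<noteq> j \<longrightarrow> {i, j} \<in> E \<longrightarrow> ip n (v i) (v j) \<le> - 1 / (k - 1))"

definition strict_vector_coloring :: "nat \<Rightarrow> nat set set \<Rightarrow> real \<Rightarrow> (nat \<Rightarrow> nat \<Rightarrow> real) \<Rightarrow> bool" where
  "strict_vector_coloring n E k v \<longleftrightarrow> unit_vecs n v \<and>
     (\<forall>i<n. \<forall>j<n. i \<noteq> j \<longrightarrow> {i, j} \<in> E \<longrightarrow> ip n (v i) (v j) = - 1 / (k - 1))"

definition rigid_vector_coloring :: "nat \<Rightarrow> nat set set \<Rightarrow> real \<Rightarrow> (nat \<Rightarrow> nat \<Rightarrow> real) \<Rightarrow> bool" where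
  "rigid_vector_coloring n E k v \<longleftrightarrow> unit_vecs n v \<and>
     (\<forall>i<n. \<forall>j<n. i \<noteq> j \<longrightarrow> {i, j} \<in> E \<longrightarrow> ip n (v i) (v j) = - 1 / (k - 1)) \<and>
     (\<forall>i<n. \<forall>j<n. i \<noteq> j \<longrightarrow> {i, j} \<notin> E \<longrightarrow> ip n (v i) (v j) \<ge> - 1 / (k - 1))"

definition theta_bar_half :: "nat \<Rightarrow> nat set set \<Rightarrow> real" where
  "theta_bar_half n E = Inf {k. k > 1 \<and> (\<exists>v. vector_coloring n E k v)}"

definition theta_bar :: "nat \<Rightarrow> nat set set \<Rightarrow> real" where
  "theta_bar n E = Inf {k. k > 1 \<and> (\<exists>v. strict_vector_coloring n E k v)}"

definition theta_bar_2 :: "nat \<Rightarrow> nat set set \<Rightarrow> real" where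
  "theta_bar_2 n E = Inf {k. k > 1 \<and> (\<exists>v. rigid_vector_coloring n E k v)}"

definition compl_graph :: "nat \<Rightarrow> nat set set \<Rightarrow> nat set set" where
  "compl_graph n E = all_pairs n - E"

definition theta_half :: "nat \<Rightarrow> nat set set \<Rightarrow> real" where
  "theta_half n E = theta_bar_half n (compl_graph n E)"

definition theta :: "nat \<Rightarrow> nat set set \<Rightarrow> real" where
  "theta n E = theta_bar n (compl_graph n E)"

definition theta_2 :: "nat \<Rightarrow> nat set set \<Rightarrow> real" where
  "theta_2 n E = theta_bar_2 n (compl_graph n E)"

definition gnp_prob :: "nat \<Rightarrow> real \<Rightarrow> (nat set set \<Rightarrow> bool) \<Rightarrow> real" where
  "gnp_prob n p P = (\<Sum>E\<in>{E. E \<subseteq> all_pairs n \<and> P E}.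
      p ^ card E * (1 - p) ^ (card (all_pairs n) - card E))"

definition is_median :: "nat \<Rightarrow> real \<Rightarrow> (nat \<Rightarrow> nat set set \<Rightarrow> real) \<Rightarrow> real \<Rightarrow> bool" where
  "is_median n p f m \<longleftrightarrow> gnp_prob n p (\<lambda>E. f n E \<le> m) \<ge> 1/2 \<and> gnp_prob n p (\<lambda>E. f n E \<ge> m) \<ge> 1/2"

end

theory Submission
  imports Defs "HOL-Analysis.Analysis"
begin

text \<open>By semidefinite duality each of the three numbers is the maximum of the sum of the entries of a
  psd matrix \<open>B\<close> of trace 1 whose off-diagonal entries obey sign conditions given by the graph.
  Rescaling row and column \<open>i\<close> of an optimal \<open>B\<close> shows that its \<open>i\<close>-th row sum is \<open>\<theta> * B i i\<close>. Put
  \<open>w i = \<theta> * B i i\<close>. These weights lie in \<open>[0, 1]\<close> and add up to \<open>\<theta>\<close>, and the Cauchy-Schwarz inequality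
  for \<open>B\<close> shows that any graph agreeing with the given one on a vertex set \<open>T\<close> has value at least
  \<open>\<Sum>i\<in>T. w i\<close>. So \<open>\<theta>\<close> drops by at most \<open>\<Sum>i\<in>S. w i\<close> when the edges at the vertices of \<open>S\<close> are
  changed, and \<open>\<Sum>i. (w i)\<^sup>2 \<le> \<theta>\<close>. Talagrand's convex distance inequality, applied to
  vertex exposure, then gives \<open>Pr(\<theta> \<le> a) * Pr(\<theta> \<ge> b) \<le> exp (- (b - a)\<^sup>2 / (4 * b))\<close> for \<open>0 < a \<le> b\<close>, and
  both tails follow by taking \<open>a\<close> or \<open>b\<close> to be the median.\<close>

section \<open>Talagrand's inequality for random subsets\<close>

text \<open>The law of a random subset of \<open>U\<close> that keeps each element independently
  with probability \<open>p\<close>. With \<open>U = all_pairs n\<close> these are the weights in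
  \<open>gnp_prob\<close>.\<close>

definition bern :: "real \<Rightarrow> 'a set \<Rightarrow> 'a set \<Rightarrow> real" where
  "bern p U E = p ^ card E * (1 - p) ^ (card U - card E)"

lemma bern_pos: "0 < p \<Longrightarrow> p < 1 \<Longrightarrow> 0 < bern p U E"
  by (simp add: bern_def)

lemma bern_Un:
  assumes "finite A" "finite B" "A \<inter> B = {}" "E \<subseteq> A" "F \<subseteq> B"
  shows "bern p (A \<union> B) (E \<union> F) = bern p A E * bern p B F"
proof -
  have f: "finite E" "finite F" "E \<inter> F = {}"
    using assms by (auto intro: finite_subset)
  have c: "card E \<le> card A" "card F \<le> card B"
    using assms by (auto intro: card_mono)
  have "card A + card B - (card E + card F) = (card A - card E) + (card B - card F)"
    using c by simp
  then show ?thesis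
    using assms f by (simp add: bern_def card_Un_disjoint power_add)
qed

lemma sum_Pow_Un:
  assumes "A \<inter> B = {}"
  shows "(\<Sum>x\<in>Pow (A \<union> B). f x) = (\<Sum>w\<in>Pow B. \<Sum>x\<in>Pow A. f (x \<union> w))"
proof -
  have "(\<Sum>x\<in>Pow (A \<union> B). f x) = (\<Sum>(w, x)\<in>Pow B \<times> Pow A. f (x \<union> w))"
  proof (rule sum.reindex_bij_witness[of _ "\<lambda>(w, x). x \<union> w" "\<lambda>x. (x \<inter> B, x \<inter> A)"])
    fix x assume "x \<in> Pow (A \<union> B)"
    then have "x \<inter> A \<union> x \<inter> B = x" by blast
    then show "(case (x \<inter> B, x \<inter> A) of (w, x) \<Rightarrow> x \<union> w) = x"
      "(case (x \<inter> B, x \<inter> A) of (w, x) \<Rightarrow> f (x \<union> w)) = f x" by simp_all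
  qed (use assms in auto)
  then show ?thesis
    by (simp add: sum.cartesian_product)
qed

lemma sum_bern: "finite U \<Longrightarrow> (\<Sum>E\<in>Pow U. bern p U E) = 1"
proof -
  assume f: "finite U"
  have "1 = (\<Prod>i\<in>U. p + (1 - p))" by simp
  also have "\<dots> = (\<Sum>E\<in>Pow U. (\<Prod>i\<in>E. p) * (\<Prod>i\<in>U - E. 1 - p))"
    by (rule prod_add[OF f])
  also have "\<dots> = (\<Sum>E\<in>Pow U. bern p U E)"
    using f by (intro sum.cong) (auto simp: bern_def card_Diff_subset finite_subset)
  finally show ?thesis by simp
qed

section \<open>Scalar inequalities for the induction over blocks\<close>

lemma ln_two_minus_bound:
  fixes r :: real
  assumes "0 < r" "r \<le> 1"
  shows "0 \<le> ln (2 - r) + ln r + (ln r)\<^sup>2"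
proof -
  have h: "1 - x / (2 - x) + 2 * ln x \<le> 0" if "0 < x" "x \<le> 1" for x :: real
  proof -
    have "(\<lambda>x::real. 1 - x / (2 - x) + 2 * ln x) x \<le> (\<lambda>x. 1 - x / (2 - x) + 2 * ln x) 1"
    proof (rule DERIV_nonneg_imp_nondecreasing[OF \<open>x \<le> 1\<close>])
      fix y assume y: "x \<le> y" "y \<le> 1"
      have "y \<le> (2 - y)\<^sup>2"
        using mult_mono[of 1 "2 - y" 1 "2 - y"] y by (simp add: power2_eq_square)
      then have "0 \<le> 2 / y - 2 / (2 - y)\<^sup>2"
        using y that by (simp add: field_simps)
      moreover have "((\<lambda>x. 1 - x / (2 - x) + 2 * ln x) has_real_derivative 2 / y - 2 / (2 - y)\<^sup>2) (at y)"
        using y that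
        by (auto intro!: derivative_eq_intros simp: power2_eq_square)
      ultimately show "\<exists>z. ((\<lambda>x. 1 - x / (2 - x) + 2 * ln x) has_real_derivative z) (at y) \<and> 0 \<le> z"
        by blast
    qed
    then show ?thesis by simp
  qed
  \<comment> \<open>The expression vanishes at 1, and its derivative is the left side of
    \<open>h\<close> divided by \<open>y\<close>, hence nonpositive. That left side in turn
    increases to its value 0 at 1, because y \<le> 1 \<le> (2 - y)^2.\<close>
  have "(\<lambda>x. ln (2 - x) + ln x + (ln x)\<^sup>2) 1 \<le> (\<lambda>x. ln (2 - x) + ln x + (ln x)\<^sup>2) r"
  proof (rule DERIV_nonpos_imp_nonincreasing[OF \<open>r \<le> 1\<close>])
    fix y assume y: "r \<le> y" "y \<le> 1"
    have "(1 - y / (2 - y) + 2 * ln y) / y \<le> 0"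
      using h[of y] y assms by (simp add: divide_nonpos_pos)
    moreover have "((\<lambda>x. ln (2 - x) + ln x + (ln x)\<^sup>2) has_real_derivative
        (1 - y / (2 - y) + 2 * ln y) / y) (at y)"
      using y assms
      by (auto intro!: derivative_eq_intros simp: power2_eq_square) (auto simp: field_simps)
    ultimately show "\<exists>z. ((\<lambda>x. ln (2 - x) + ln x + (ln x)\<^sup>2) has_real_derivative z) (at y) \<and> z \<le> 0"
      by blast
  qed
  then show ?thesis by simp
qed

text \<open>The exponent is a convex quadratic in \<open>l\<close>, minimal at
  \<open>1 + 2 * ln r\<close>. If this point is nonnegative, it gives the exponent - ln r - (ln
  r)^2, which the preceding inequality bounds. Otherwise the best admissible choice is
  \<open>l = 0\<close>.\<close>

lemma talagrand_exponent:
  fixes r :: real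
  assumes "0 < r" "r \<le> 1"
  shows "\<exists>l. 0 \<le> l \<and> l \<le> 1 \<and> exp ((1 - l)\<^sup>2 / 4 - l * ln r) \<le> 2 - r"
proof (cases "- 1 / 2 \<le> ln r")
  case True
  have "exp ((1 - (1 + 2 * ln r))\<^sup>2 / 4 - (1 + 2 * ln r) * ln r) = exp (- ln r - (ln r)\<^sup>2)"
    by (simp add: power2_eq_square algebra_simps)
  also have "\<dots> \<le> exp (ln (2 - r))"
    using ln_two_minus_bound[OF assms] by simp
  also have "\<dots> = 2 - r" using assms by simp
  finally show ?thesis
    using True assms by (intro exI[of _ "1 + 2 * ln r"]) auto
next
  case False
  then have "r < exp (- 1 / 2)"
    using assms by (metis not_le exp_less_mono exp_ln)
  also have "\<dots> = inverse (exp (1/4)) ^ 2"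
    by (simp add: exp_minus power_inverse flip: exp_of_nat_mult)
  finally have r: "r < inverse (exp (1/4)) ^ 2" .
  \<comment> \<open>Numerically, \<open>r\<close> is below 0.64 and exp (1/4) is at most
    1.32.\<close>
  have e2: "1 + 1/4 \<le> exp (1/4::real)" using exp_ge_add_one_self[of "1/4"] by simp
  have e3: "exp (1/4::real) \<le> 1.32" using exp_bound[of "1/4::real"] by (simp add: power2_eq_square)
  have "inverse (exp (1/4::real)) \<le> inverse (1.25)" using e2 by (intro le_imp_inverse_le) auto
  then have "inverse (exp (1/4::real)) ^ 2 \<le> (inverse 1.25)^2" by (intro power_mono) auto
  then have "exp (1/4) \<le> 2 - r" using r e3 by (simp add: power2_eq_square)
  then show ?thesis by (intro exI[of _ 0]) auto
qed

text \<open>Talagrand's convex distance in dual form: \<open>covers P N A x s\<close> says that \<open>s\<close> dominates a point of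
  the convex hull of the vectors indicating the blocks \<open>P i\<close> in which \<open>x\<close> differs from some
  \<open>y \<in> A\<close>. In this form no convex hull, and no minimax theorem, is ever needed.\<close>

definition covers :: "(nat \<Rightarrow> 'a set) \<Rightarrow> nat \<Rightarrow> 'a set set \<Rightarrow> 'a set \<Rightarrow> (nat \<Rightarrow> real) \<Rightarrow> bool" where
  "covers P N A x s \<longleftrightarrow> (\<forall>w c. (\<forall>i. 0 \<le> w i) \<longrightarrow>
     (\<forall>y\<in>A. c \<le> (\<Sum>i<N. w i * of_bool (x \<inter> P i \<noteq> y \<inter> P i))) \<longrightarrow> c \<le> (\<Sum>i<N. w i * s i))"

lemma coversD:
  assumes "covers P N A x s" "\<And>i. 0 \<le> w i"
    "\<And>y. y \<in> A \<Longrightarrow> c \<le> (\<Sum>i<N. w i * of_bool (x \<inter> P i \<noteq> y \<inter> P i))"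
  shows "c \<le> (\<Sum>i<N. w i * s i)"
  using assms unfolding covers_def by blast

lemma covers_convex:
  assumes s: "covers P N A x s" and t: "covers P N A x t" and l: "0 \<le> l" "l \<le> 1"
  shows "covers P N A x (\<lambda>i. l * s i + (1 - l) * t i)"
  unfolding covers_def
proof (intro allI impI)
  fix w :: "nat \<Rightarrow> real" and c
  assume w: "\<forall>i. 0 \<le> w i"
    and c: "\<forall>y\<in>A. c \<le> (\<Sum>i<N. w i * of_bool (x \<inter> P i \<noteq> y \<inter> P i))"
  have "c \<le> (\<Sum>i<N. w i * s i)" "c \<le> (\<Sum>i<N. w i * t i)"
    using coversD[OF s] coversD[OF t] w c by auto
  then have "l * c + (1 - l) * c \<le> l * (\<Sum>i<N. w i * s i) + (1 - l) * (\<Sum>i<N. w i * t i)"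
    using l by (intro add_mono mult_left_mono) auto
  also have "\<dots> = (\<Sum>i<N. w i * (l * s i + (1 - l) * t i))"
    by (simp add: sum_distrib_left sum.distrib[symmetric] algebra_simps)
  finally show "c \<le> (\<Sum>i<N. w i * (l * s i + (1 - l) * t i))"
    by (simp add: algebra_simps)
qed

text \<open>Adds one block: the term \<open>w N * s' N\<close> is moved into the constant
  \<open>c\<close>, and each point of \<open>B\<close> is lifted to a point of \<open>A\<close> that
  agrees with it on the earlier blocks. It serves for projections, where block \<open>N\<close> may
  differ and costs 1, and for slices, where it agrees and costs 0.\<close>

lemma covers_extend:
  assumes cov: "covers P N B x s" and s: "\<And>i. i < N \<Longrightarrow> s' i = s i" and "0 \<le> s' N"
    and xz: "\<And>i. i < N \<Longrightarrow> z \<inter> P i = x \<inter> P i"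
    and ext: "\<And>y. y \<in> B \<Longrightarrow> \<exists>y'\<in>A. (\<forall>i<N. y' \<inter> P i = y \<inter> P i) \<and>
                (z \<inter> P N \<noteq> y' \<inter> P N \<longrightarrow> 1 \<le> s' N)"
  shows "covers P (Suc N) A z s'"
  unfolding covers_def
proof (intro allI impI)
  fix w :: "nat \<Rightarrow> real" and c
  assume w: "\<forall>i. 0 \<le> w i"
    and c: "\<forall>y\<in>A. c \<le> (\<Sum>i<Suc N. w i * of_bool (z \<inter> P i \<noteq> y \<inter> P i))"
  have "c - w N * s' N \<le> (\<Sum>i<N. w i * s i)"
  proof (rule coversD[OF cov])
    fix y assume "y \<in> B"
    then obtain y' where y': "y' \<in> A" "\<forall>i<N. y' \<inter> P i = y \<inter> P i"
        "z \<inter> P N \<noteq> y' \<inter> P N \<longrightarrow> 1 \<le> s' N"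
      using ext by blast
    have "w N * of_bool (z \<inter> P N \<noteq> y' \<inter> P N) \<le> w N * s' N"
      using y'(3) w \<open>0 \<le> s' N\<close> by (intro mult_left_mono) auto
    moreover have "(\<Sum>i<N. w i * of_bool (z \<inter> P i \<noteq> y' \<inter> P i))
        = (\<Sum>i<N. w i * of_bool (x \<inter> P i \<noteq> y \<inter> P i))"
      using y'(2) xz by (intro sum.cong) auto
    ultimately show "c - w N * s' N \<le> (\<Sum>i<N. w i * of_bool (x \<inter> P i \<noteq> y \<inter> P i))"
      using c y'(1) by fastforce
  qed (use w in auto)
  also have "(\<Sum>i<N. w i * s i) = (\<Sum>i<N. w i * s' i)" using s by simp
  finally show "c \<le> (\<Sum>i<Suc N. w i * s' i)" by simp
qed

text \<open>Hoelder's inequality in exponential form. After shifting the exponents by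
  \<open>a\<close> and \<open>b\<close>, both sums are at most 1 and convexity of exp
  suffices.\<close>

lemma sum_exp_interpolate:
  fixes X Y :: "'a \<Rightarrow> real"
  assumes \<mu>: "\<And>x. x \<in> S \<Longrightarrow> 0 \<le> \<mu> x" and l: "0 \<le> l" "l \<le> 1"
    and X: "(\<Sum>x\<in>S. \<mu> x * exp (X x)) \<le> exp a"
    and Y: "(\<Sum>x\<in>S. \<mu> x * exp (Y x)) \<le> exp b"
  shows "(\<Sum>x\<in>S. \<mu> x * exp (l * X x + (1 - l) * Y x)) \<le> exp (l * a + (1 - l) * b)"
proof -
  have conv: "exp (l * u + (1 - l) * v) \<le> l * exp u + (1 - l) * exp v" for u v :: real
    using convex_onD[OF exp_convex, of l v u] l by (simp add: algebra_simps)
  have "(\<Sum>x\<in>S. \<mu> x * exp (l * X x + (1 - l) * Y x))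
      = exp (l * a + (1 - l) * b) * (\<Sum>x\<in>S. \<mu> x * exp (l * (X x - a) + (1 - l) * (Y x - b)))"
    by (simp add: sum_distrib_left mult.left_commute algebra_simps flip: exp_add)
  also have "\<dots> \<le> exp (l * a + (1 - l) * b) *
      (\<Sum>x\<in>S. \<mu> x * (l * exp (X x - a) + (1 - l) * exp (Y x - b)))"
    using \<mu> conv by (intro mult_left_mono sum_mono) auto
  also have "(\<Sum>x\<in>S. \<mu> x * (l * exp (X x - a) + (1 - l) * exp (Y x - b)))
      = l * ((\<Sum>x\<in>S. \<mu> x * exp (X x)) / exp a) + (1 - l) * ((\<Sum>x\<in>S. \<mu> x * exp (Y x)) / exp b)"
    by (simp add: sum_distrib_left sum_divide_distrib sum.distrib exp_diff algebra_simps)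
  also have "\<dots> \<le> l * 1 + (1 - l) * 1"
    using X Y l by (intro add_mono mult_left_mono) auto
  finally show ?thesis by simp
qed

text \<open>The induction step of Talagrand's argument on one value of the last coordinate: \<open>a\<close> and \<open>b\<close> are
  the measures of the projection and of the slice, and the witnesses \<open>t\<close>, \<open>s\<close> obtained
  for these two sets are interpolated.\<close>

lemma talagrand_slice:
  fixes P :: "nat \<Rightarrow> 'a set"
  assumes \<mu>: "\<And>x. x \<in> X \<Longrightarrow> 0 \<le> \<mu> x"
    and t: "\<And>x. x \<in> X \<Longrightarrow> covers P (Suc N) A (g x) ((t x)(N := 1))"
    and ta: "(\<Sum>x\<in>X. \<mu> x * exp ((\<Sum>i<N. (t x i)\<^sup>2) / 4)) \<le> 1 / a"
    and s: "\<And>x. b \<noteq> 0 \<Longrightarrow> x \<in> X \<Longrightarrow> covers P (Suc N) A (g x) ((s x)(N := 0))"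
    and sb: "b \<noteq> 0 \<Longrightarrow> (\<Sum>x\<in>X. \<mu> x * exp ((\<Sum>i<N. (s x i)\<^sup>2) / 4)) \<le> 1 / b"
    and ab: "0 < a" "0 \<le> b" "b \<le> a"
  shows "\<exists>\<sigma>. (\<forall>x\<in>X. covers P (Suc N) A (g x) (\<sigma> x)) \<and>
     (\<Sum>x\<in>X. \<mu> x * exp ((\<Sum>i<Suc N. (\<sigma> x i)\<^sup>2) / 4)) \<le> (2 - b / a) / a"
proof (cases "b = 0")
  case True
  \<comment> \<open>Without a slice witness the projection witness is used alone; its last
    coordinate 1 costs the factor exp (1/4) \<le> 2.\<close>
  have "(\<Sum>x\<in>X. \<mu> x * exp ((\<Sum>i<Suc N. (((t x)(N := 1)) i)\<^sup>2) / 4))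
      = exp (1/4) * (\<Sum>x\<in>X. \<mu> x * exp ((\<Sum>i<N. (t x i)\<^sup>2) / 4))"
    by (simp add: sum_distrib_left add_divide_distrib exp_add mult_ac)
  also have "\<dots> \<le> 2 * (1 / a)"
    using exp_bound_half[of "1/4::real"] exp_bound[of "1/4::real"] ta ab \<mu>
    by (intro mult_mono sum_nonneg) (auto simp: power2_eq_square)
  finally show ?thesis
    using t True by (intro exI[of _ "\<lambda>x. (t x)(N := 1)"]) auto
next
  case False
  then have b: "0 < b" using ab by simp
  obtain l where l: "0 \<le> l" "l \<le> 1" "exp ((1 - l)\<^sup>2 / 4 - l * ln (b / a)) \<le> 2 - b / a"
    using talagrand_exponent[of "b / a"] b ab by auto
  define \<sigma> where "\<sigma> = (\<lambda>x i. l * ((s x)(N := 0)) i + (1 - l) * ((t x)(N := 1)) i)"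
  have sq: "(l * u + (1 - l) * v)\<^sup>2 \<le> l * u\<^sup>2 + (1 - l) * v\<^sup>2" for u v :: real
  proof -
    have "l * u\<^sup>2 + (1 - l) * v\<^sup>2 - (l * u + (1 - l) * v)\<^sup>2 = l * (1 - l) * (u - v)\<^sup>2"
      by (simp add: power2_eq_square algebra_simps)
    moreover have "0 \<le> l * (1 - l) * (u - v)\<^sup>2" using l by simp
    ultimately show ?thesis by simp
  qed
  \<comment> \<open>The last coordinate of \<open>\<sigma> x\<close> is \<open>1 - l\<close>, whence
    the final summand; the other coordinates are handled by convexity of the square.\<close>
  have len: "(\<Sum>i<Suc N. (\<sigma> x i)\<^sup>2) / 4
      \<le> l * ((\<Sum>i<N. (s x i)\<^sup>2) / 4) + (1 - l) * ((\<Sum>i<N. (t x i)\<^sup>2) / 4) + (1 - l)\<^sup>2 / 4" for x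
  proof -
    have "(\<Sum>i<N. (\<sigma> x i)\<^sup>2) \<le> (\<Sum>i<N. l * (s x i)\<^sup>2 + (1 - l) * (t x i)\<^sup>2)"
      using sq by (intro sum_mono) (auto simp: \<sigma>_def)
    also have "\<dots> = l * (\<Sum>i<N. (s x i)\<^sup>2) + (1 - l) * (\<Sum>i<N. (t x i)\<^sup>2)"
      by (simp add: sum.distrib sum_distrib_left)
    finally show ?thesis by (simp add: \<sigma>_def)
  qed
  have "(\<Sum>x\<in>X. \<mu> x * exp ((\<Sum>i<Suc N. (\<sigma> x i)\<^sup>2) / 4))
      \<le> (\<Sum>x\<in>X. \<mu> x * exp (l * ((\<Sum>i<N. (s x i)\<^sup>2) / 4) + (1 - l) * ((\<Sum>i<N. (t x i)\<^sup>2) / 4)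
            + (1 - l)\<^sup>2 / 4))"
    using len \<mu> by (intro sum_mono mult_left_mono) auto
  also have "\<dots> = exp ((1 - l)\<^sup>2 / 4) *
      (\<Sum>x\<in>X. \<mu> x * exp (l * ((\<Sum>i<N. (s x i)\<^sup>2) / 4) + (1 - l) * ((\<Sum>i<N. (t x i)\<^sup>2) / 4)))"
    by (simp add: sum_distrib_left exp_add mult_ac)
  also have "\<dots> \<le> exp ((1 - l)\<^sup>2 / 4) * exp (l * (- ln b) + (1 - l) * (- ln a))"
    using sb[OF False] ta b ab \<mu> l
    by (intro mult_left_mono sum_exp_interpolate) (auto simp: exp_minus inverse_eq_divide)
  also have "\<dots> = exp ((1 - l)\<^sup>2 / 4 - l * ln (b / a)) * exp (- ln a)"
    using b ab by (simp add: ln_div algebra_simps flip: exp_add)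
  also have "\<dots> \<le> (2 - b / a) * exp (- ln a)"
    using l by (intro mult_right_mono) auto
  also have "\<dots> = (2 - b / a) / a"
    using ab by (simp add: exp_minus inverse_eq_divide)
  finally have "(\<Sum>x\<in>X. \<mu> x * exp ((\<Sum>i<Suc N. (\<sigma> x i)\<^sup>2) / 4)) \<le> (2 - b / a) / a" .
  moreover have "covers P (Suc N) A (g x) (\<sigma> x)" if "x \<in> X" for x
    unfolding \<sigma>_def using s[OF False that] t[OF that] l(1,2) by (rule covers_convex)
  ultimately show ?thesis by blast
qed

text \<open>Induction on the number of blocks. For each value \<open>w\<close> of the last block,
  the hypothesis is applied to the projection of \<open>A\<close> and to its slice at
  \<open>w\<close>, and the two witnesses are interpolated. Averaging over \<open>w\<close> replaces
  the slice measure by the measure \<open>d\<close> of \<open>A\<close>, and (2 - d/a)/a \<le> 1/d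
  because (a - d)^2 is nonnegative.\<close>

theorem talagrand_convex_distance:
  fixes P :: "nat \<Rightarrow> 'a set"
  assumes p: "0 < p" "p < 1" and fin: "\<And>i. finite (P i)"
    and disj: "\<And>i j. i \<noteq> j \<Longrightarrow> P i \<inter> P j = {}"
    and A: "A \<subseteq> Pow (\<Union>i<N. P i)" "A \<noteq> {}"
  shows "\<exists>s. (\<forall>x\<in>Pow (\<Union>i<N. P i). covers P N A x (s x)) \<and>
    (\<Sum>x\<in>Pow (\<Union>i<N. P i). bern p (\<Union>i<N. P i) x * exp ((\<Sum>i<N. (s x i)\<^sup>2) / 4))
      \<le> 1 / (\<Sum>x\<in>A. bern p (\<Union>i<N. P i) x)"
  using A
proof (induction N arbitrary: A)
  case 0
  then have "A = {{}}" by auto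
  then show ?case by (auto simp: bern_def covers_def)
next
  case (Suc N)
  define U where "U = (\<Union>i<N. P i)"
  define Q where "Q = P N"
  have UQ: "(\<Union>i<Suc N. P i) = U \<union> Q" by (auto simp: U_def Q_def lessThan_Suc)
  have finU: "finite U" "finite Q" using fin by (auto simp: U_def Q_def)
  have "P i \<inter> Q = {}" if "i < N" for i using disj[of i N] that by (simp add: Q_def)
  then have dUQ: "U \<inter> Q = {}" by (auto simp: U_def)
  note A = Suc.prems[unfolded UQ]
  have pos: "0 < (\<Sum>x\<in>B. bern p V x)" if "B \<subseteq> Pow V" "B \<noteq> {}" "finite V" for B and V :: "'a set"
    using that p by (intro sum_pos bern_pos) (auto intro: finite_subset)
  define proj where "proj = (\<lambda>y. y \<inter> U) ` A"
  define slice where "slice w = {y \<in> Pow U. y \<union> w \<in> A}" for w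
  define a where "a = (\<Sum>x\<in>proj. bern p U x)"
  define b where "b w = (\<Sum>x\<in>slice w. bern p U x)" for w
  have projU: "proj \<subseteq> Pow U" "proj \<noteq> {}" using A by (auto simp: proj_def)
  have a: "0 < a" unfolding a_def using pos projU finU by auto
  have slice_sub: "slice w \<subseteq> proj" if "w \<subseteq> Q" for w
  proof
    fix y assume "y \<in> slice w"
    then have "y \<subseteq> U" "y \<union> w \<in> A" by (auto simp: slice_def)
    moreover have "(y \<union> w) \<inter> U = y" using \<open>y \<subseteq> U\<close> that dUQ by blast
    ultimately show "y \<in> proj" unfolding proj_def by (metis image_eqI)
  qed
  have b: "0 \<le> b w" "b w \<le> a" if "w \<subseteq> Q" for w
  proof -
    have "finite proj" using projU finU by (meson finite_Pow_iff finite_subset)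
    then show "b w \<le> a"
      unfolding a_def b_def using slice_sub[OF that] p
      by (intro sum_mono2 less_imp_le[OF bern_pos]) auto
    show "0 \<le> b w"
      unfolding b_def using p by (intro sum_nonneg less_imp_le[OF bern_pos]) auto
  qed
  obtain t where t: "\<And>x. x \<in> Pow U \<Longrightarrow> covers P N proj x (t x)"
      "(\<Sum>x\<in>Pow U. bern p U x * exp ((\<Sum>i<N. (t x i)\<^sup>2) / 4)) \<le> 1 / a"
    using Suc.IH[of proj] projU unfolding U_def[symmetric] a_def by blast
  have PU: "P i \<subseteq> U" if "i < N" for i using that by (auto simp: U_def)
  have cutU: "(x \<union> w) \<inter> P i = x \<inter> P i" if "i < N" "w \<subseteq> Q" for x w i
    using PU[OF that(1)] that dUQ by blast
  have cutQ: "(x \<union> w) \<inter> P N = w" if "x \<subseteq> U" "w \<subseteq> Q" for x w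
    using that dUQ unfolding Q_def by blast
  have "\<forall>w\<in>Pow Q. \<exists>\<sigma>. (\<forall>x\<in>Pow U. covers P (Suc N) A (x \<union> w) (\<sigma> x)) \<and>
     (\<Sum>x\<in>Pow U. bern p U x * exp ((\<Sum>i<Suc N. (\<sigma> x i)\<^sup>2) / 4)) \<le> (2 - b w / a) / a"
  proof
    fix w assume "w \<in> Pow Q"
    then have w: "w \<subseteq> Q" by simp
    \<comment> \<open>A slice of measure 0 is empty and has no witness; both claims are then
      vacuous.\<close>
    obtain s where s: "b w \<noteq> 0 \<Longrightarrow> (\<forall>x\<in>Pow U. covers P N (slice w) x (s x))"
      "b w \<noteq> 0 \<Longrightarrow> (\<Sum>x\<in>Pow U. bern p U x * exp ((\<Sum>i<N. (s x i)\<^sup>2) / 4)) \<le> 1 / b w"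
    proof (cases "b w = 0")
      case False
      then have "slice w \<noteq> {}" by (metis b_def sum.empty)
      moreover have "slice w \<subseteq> Pow U" by (auto simp: slice_def)
      ultimately obtain s where "\<forall>x\<in>Pow U. covers P N (slice w) x (s x)"
        "(\<Sum>x\<in>Pow U. bern p U x * exp ((\<Sum>i<N. (s x i)\<^sup>2) / 4)) \<le> 1 / b w"
        using Suc.IH[of "slice w", folded U_def] unfolding b_def by blast
      then show ?thesis by (rule that)
    qed (rule that, simp_all)
    show "\<exists>\<sigma>. (\<forall>x\<in>Pow U. covers P (Suc N) A (x \<union> w) (\<sigma> x)) \<and>
     (\<Sum>x\<in>Pow U. bern p U x * exp ((\<Sum>i<Suc N. (\<sigma> x i)\<^sup>2) / 4)) \<le> (2 - b w / a) / a"
    proof (rule talagrand_slice)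
      fix x assume x: "x \<in> Pow U"
      show "0 \<le> bern p U x" using p by (intro less_imp_le bern_pos)
      show "covers P (Suc N) A (x \<union> w) ((t x)(N := 1))"
      proof (rule covers_extend[OF t(1)[OF x]])
        fix y assume "y \<in> proj"
        then obtain y' where "y' \<in> A" "y = y' \<inter> U" by (auto simp: proj_def)
        moreover have "y' \<inter> U \<inter> P i = y' \<inter> P i" if "i < N" for i using PU[OF that] by blast
        ultimately show "\<exists>y'\<in>A. (\<forall>i<N. y' \<inter> P i = y \<inter> P i) \<and>
            ((x \<union> w) \<inter> P N \<noteq> y' \<inter> P N \<longrightarrow> 1 \<le> ((t x)(N := 1)) N)"
          by auto
      qed (use w cutU in auto)
      show "covers P (Suc N) A (x \<union> w) ((s x)(N := 0))" if "b w \<noteq> 0"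
      proof (rule covers_extend)
        show "covers P N (slice w) x (s x)" using s(1) that x by blast
        fix y assume "y \<in> slice w"
        then have "y \<union> w \<in> A" "y \<subseteq> U" by (auto simp: slice_def)
        then show "\<exists>y'\<in>A. (\<forall>i<N. y' \<inter> P i = y \<inter> P i) \<and>
            ((x \<union> w) \<inter> P N \<noteq> y' \<inter> P N \<longrightarrow> 1 \<le> ((s x)(N := 0)) N)"
          using w cutU cutQ x by (intro bexI[of _ "y \<union> w"]) auto
      qed (use w cutU in auto)
    next
      show "(\<Sum>x\<in>Pow U. bern p U x * exp ((\<Sum>i<N. (s x i)\<^sup>2) / 4)) \<le> 1 / b w" if "b w \<noteq> 0"
        using s(2) that .
    qed (fact t(2) a b(1)[OF w] b(2)[OF w])+
  qed
  from bchoice[OF this] obtain \<sigma> where \<sigma>: "\<And>w x. w \<in> Pow Q \<Longrightarrow> x \<in> Pow U \<Longrightarrow> covers P (Suc N) A (x \<union> w) (\<sigma> w x)"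
     "\<And>w. w \<in> Pow Q \<Longrightarrow>
       (\<Sum>x\<in>Pow U. bern p U x * exp ((\<Sum>i<Suc N. (\<sigma> w x i)\<^sup>2) / 4)) \<le> (2 - b w / a) / a"
    by blast
  \<comment> \<open>The last block of \<open>z\<close> selects the family of witnesses to be
    used.\<close>
  define S where "S z = \<sigma> (z \<inter> Q) (z \<inter> U)" for z
  have S: "S (x \<union> w) = \<sigma> w x" if "x \<subseteq> U" "w \<subseteq> Q" for x w
  proof -
    have "(x \<union> w) \<inter> Q = w" "(x \<union> w) \<inter> U = x" using that dUQ by blast+
    then show ?thesis by (simp add: S_def)
  qed
  define d where "d = (\<Sum>x\<in>A. bern p (U \<union> Q) x)"
  have d0: "0 < d" unfolding d_def using pos[of A "U \<union> Q"] A finU by auto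
  have bU: "bern p (U \<union> Q) (x \<union> w) = bern p U x * bern p Q w" if "x \<in> Pow U" "w \<in> Pow Q" for x w
    using bern_Un[of U Q x w p] finU dUQ that by auto
  have "d = (\<Sum>x\<in>Pow (U \<union> Q). if x \<in> A then bern p (U \<union> Q) x else 0)"
    unfolding d_def using A finU by (intro sum.mono_neutral_cong_left) auto
  also have "\<dots> = (\<Sum>w\<in>Pow Q. \<Sum>x\<in>Pow U. if x \<union> w \<in> A then bern p U x * bern p Q w else 0)"
    unfolding sum_Pow_Un[OF dUQ] using bU by (intro sum.cong) auto
  also have "\<dots> = (\<Sum>w\<in>Pow Q. bern p Q w * b w)"
  proof (rule sum.cong[OF refl])
    fix w
    have "b w = (\<Sum>x\<in>Pow U. if x \<union> w \<in> A then bern p U x else 0)"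
      unfolding b_def slice_def using finU by (intro sum.mono_neutral_cong_left) auto
    then show "(\<Sum>x\<in>Pow U. if x \<union> w \<in> A then bern p U x * bern p Q w else 0) = bern p Q w * b w"
      by (simp add: sum_distrib_left if_distrib mult_ac cong: if_cong)
  qed
  finally have d: "d = (\<Sum>w\<in>Pow Q. bern p Q w * b w)" .
  have "(\<Sum>z\<in>Pow (U \<union> Q). bern p (U \<union> Q) z * exp ((\<Sum>i<Suc N. (S z i)\<^sup>2) / 4))
      = (\<Sum>w\<in>Pow Q. bern p Q w * (\<Sum>x\<in>Pow U. bern p U x * exp ((\<Sum>i<Suc N. (\<sigma> w x i)\<^sup>2) / 4)))"
    unfolding sum_Pow_Un[OF dUQ] sum_distrib_left
    using bU S by (intro sum.cong refl) (auto simp: mult_ac)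
  also have "\<dots> \<le> (\<Sum>w\<in>Pow Q. bern p Q w * ((2 - b w / a) / a))"
    using \<sigma>(2) p by (intro sum_mono mult_left_mono less_imp_le[OF bern_pos]) auto
  also have "\<dots> = (2 * (\<Sum>w\<in>Pow Q. bern p Q w) - d / a) / a"
    unfolding d by (simp add: sum_distrib_left sum_divide_distrib sum_subtractf algebra_simps diff_divide_distrib)
  also have "\<dots> = (2 - d / a) / a"
    using sum_bern[OF finU(2)] by simp
  also have "\<dots> \<le> 1 / d"
  proof -
    have "1 / d - (2 - d / a) / a = (a - d)\<^sup>2 / (d * a\<^sup>2)"
      using a d0 by (simp add: field_simps power2_eq_square)
    moreover have "0 \<le> (a - d)\<^sup>2 / (d * a\<^sup>2)" using d0 by simp
    ultimately show ?thesis by linarith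
  qed
  finally have "(\<Sum>z\<in>Pow (U \<union> Q). bern p (U \<union> Q) z * exp ((\<Sum>i<Suc N. (S z i)\<^sup>2) / 4)) \<le> 1 / d" .
  moreover have "covers P (Suc N) A z (S z)" if "z \<in> Pow (U \<union> Q)" for z
  proof -
    have "z = z \<inter> U \<union> z \<inter> Q" using that by blast
    then show ?thesis using \<sigma>(1)[of "z \<inter> Q" "z \<inter> U"] by (simp add: S_def)
  qed
  ultimately show ?case unfolding UQ d_def by blast
qed

text \<open>If f x \<ge> b, the weights of \<open>x\<close> tested against the witness
  \<open>s x\<close> for the set where f \<le> a give f x - a \<le> \<Sum> w i * s x i. By
  Cauchy-Schwarz and \<Sum> (w i)^2 \<le> f x, the squared length of \<open>s x\<close> is at least
  (f x - a)^2 / f x, hence at least (b - a)^2 / b. Talagrand's inequality and Markov's inequality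
  finish.\<close>

lemma certificate_concentration:
  fixes P :: "nat \<Rightarrow> 'a set" and f :: "'a set \<Rightarrow> real" and N
  defines "U \<equiv> \<Union>i<N. P i"
  assumes p: "0 < p" "p < 1" and fin: "\<And>i. finite (P i)"
    and disj: "\<And>i j. i \<noteq> j \<Longrightarrow> P i \<inter> P j = {}"
    and cert: "\<And>x. x \<subseteq> U \<Longrightarrow> \<exists>w. (\<forall>i. 0 \<le> w i \<and> w i \<le> 1) \<and> (\<Sum>i<N. w i) \<le> f x \<and>
       (\<forall>y. f x - (\<Sum>i<N. w i * of_bool (x \<inter> P i \<noteq> y \<inter> P i)) \<le> f y)"
    and ab: "0 < a" "a \<le> b"
  shows "(\<Sum>x | x \<subseteq> U \<and> f x \<le> a. bern p U x) * (\<Sum>x | x \<subseteq> U \<and> b \<le> f x. bern p U x)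
    \<le> exp (- (b - a)\<^sup>2 / (4 * b))"
proof -
  define A where "A = {x. x \<subseteq> U \<and> f x \<le> a}"
  define B where "B = {x. x \<subseteq> U \<and> b \<le> f x}"
  have finU: "finite U" using fin by (auto simp: U_def)
  have finAB: "finite A" "finite B" using finU by (auto simp: A_def B_def)
  have pos: "0 < bern p U x" for x :: "'a set" by (rule bern_pos[OF p])
  show ?thesis
  proof (cases "A = {}")
    case True
    then show ?thesis by (simp flip: A_def)
  next
    case False
    define q where "q = (\<Sum>x\<in>A. bern p U x)"
    have q: "0 < q" unfolding q_def using finAB False pos by (intro sum_pos) auto
    have AU: "A \<subseteq> Pow U" by (auto simp: A_def)
    obtain s where s: "\<And>x. x \<in> Pow U \<Longrightarrow> covers P N A x (s x)"
      and sq: "(\<Sum>x\<in>Pow U. bern p U x * exp ((\<Sum>i<N. (s x i)\<^sup>2) / 4)) \<le> 1 / q"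
      using talagrand_convex_distance[where P = P and N = N, OF p fin disj, folded U_def, OF _ AU False]
      unfolding q_def by blast
    have far: "(b - a)\<^sup>2 / (4 * b) \<le> (\<Sum>i<N. (s x i)\<^sup>2) / 4" if "x \<in> B" for x
    proof -
      have x: "x \<subseteq> U" "b \<le> f x" using that by (auto simp: B_def)
      obtain w where w: "\<And>i. 0 \<le> w i" "\<And>i. w i \<le> 1" "(\<Sum>i<N. w i) \<le> f x"
        "\<And>y. f x - (\<Sum>i<N. w i * of_bool (x \<inter> P i \<noteq> y \<inter> P i)) \<le> f y"
        using cert[OF x(1)] by blast
      have "f x - a \<le> (\<Sum>i<N. w i * s x i)"
      proof (rule coversD[OF s w(1)])
        show "f x - a \<le> (\<Sum>i<N. w i * of_bool (x \<inter> P i \<noteq> y \<inter> P i))" if "y \<in> A" for y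
          using w(4)[of y] that by (simp add: A_def)
      qed (use x in auto)
      then have "(f x - a)\<^sup>2 \<le> (\<Sum>i<N. w i * s x i)\<^sup>2"
        using x ab by (intro power_mono) auto
      also have "\<dots> \<le> (\<Sum>i<N. (w i)\<^sup>2) * (\<Sum>i<N. (s x i)\<^sup>2)"
        by (rule Cauchy_Schwarz_ineq_sum)
      also have "\<dots> \<le> f x * (\<Sum>i<N. (s x i)\<^sup>2)"
      proof (rule mult_right_mono)
        have "(\<Sum>i<N. (w i)\<^sup>2) \<le> (\<Sum>i<N. w i)"
          using w(1,2) by (intro sum_mono) (simp add: power2_eq_square mult_left_le)
        then show "(\<Sum>i<N. (w i)\<^sup>2) \<le> f x" using w(3) by simp
      qed (auto intro: sum_nonneg)
      finally have 1: "(f x - a)\<^sup>2 \<le> f x * (\<Sum>i<N. (s x i)\<^sup>2)" .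
      \<comment> \<open>Monotonicity of (t - a)^2 / t for t \<ge> a in cross-multiplied form: b * (t
        - a)^2 - t * (b - a)^2 = (t - b) * (b * t - a^2), at t = f x.\<close>
      have "a * a \<le> b * f x" using x ab by (intro mult_mono) auto
      then have "0 \<le> (f x - b) * (b * f x - a * a)" using x by simp
      then have "(b - a)\<^sup>2 * f x \<le> (f x - a)\<^sup>2 * b"
        by (simp add: power2_eq_square algebra_simps)
      also have "\<dots> \<le> f x * (\<Sum>i<N. (s x i)\<^sup>2) * b" using 1 ab by (intro mult_right_mono) auto
      finally have "(b - a)\<^sup>2 \<le> (\<Sum>i<N. (s x i)\<^sup>2) * b"
        using x ab by (simp add: mult.commute mult.left_commute)
      then show ?thesis using ab by (simp add: field_simps)
    qed
    \<comment> \<open>Markov's inequality for the exponential moment.\<close>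
    have "exp ((b - a)\<^sup>2 / (4 * b)) * (\<Sum>x\<in>B. bern p U x)
        = (\<Sum>x\<in>B. bern p U x * exp ((b - a)\<^sup>2 / (4 * b)))"
      by (simp add: sum_distrib_right mult.commute[of "exp _"])
    also have "\<dots> \<le> (\<Sum>x\<in>B. bern p U x * exp ((\<Sum>i<N. (s x i)\<^sup>2) / 4))"
      using far pos by (intro sum_mono mult_left_mono) (auto simp: less_imp_le)
    also have "\<dots> \<le> (\<Sum>x\<in>Pow U. bern p U x * exp ((\<Sum>i<N. (s x i)\<^sup>2) / 4))"
      using finU pos by (intro sum_mono2) (auto simp: B_def less_imp_le)
    also note sq
    finally have "q * (\<Sum>x\<in>B. bern p U x) \<le> 1 / exp ((b - a)\<^sup>2 / (4 * b))"
      using q by (simp add: pos_le_divide_eq mult_ac)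
    then show ?thesis unfolding q_def A_def B_def by (simp add: exp_minus inverse_eq_divide)
  qed
qed

section \<open>Positive semidefinite matrices\<close>

definition qform :: "nat \<Rightarrow> (nat \<Rightarrow> nat \<Rightarrow> real) \<Rightarrow> (nat \<Rightarrow> real) \<Rightarrow> (nat \<Rightarrow> real) \<Rightarrow> real" where
  "qform n B x y = (\<Sum>i<n. \<Sum>j<n. x i * y j * B i j)"

definition psd :: "nat \<Rightarrow> (nat \<Rightarrow> nat \<Rightarrow> real) \<Rightarrow> bool" where
  "psd n B \<longleftrightarrow> (\<forall>i j. i < n \<longrightarrow> j < n \<longrightarrow> B i j = B j i) \<and> (\<forall>x. 0 \<le> qform n B x x)"

definition trc :: "nat \<Rightarrow> (nat \<Rightarrow> nat \<Rightarrow> real) \<Rightarrow> real" where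
  "trc n B = (\<Sum>i<n. B i i)"

definition entry_sum :: "nat \<Rightarrow> (nat \<Rightarrow> nat \<Rightarrow> real) \<Rightarrow> real" where
  "entry_sum n B = (\<Sum>i<n. \<Sum>j<n. B i j)"

section \<open>Bilinear forms, Cauchy-Schwarz and Gram representations\<close>

lemma psd_sym: "psd n B \<Longrightarrow> i < n \<Longrightarrow> j < n \<Longrightarrow> B i j = B j i"
  by (auto simp: psd_def)

lemma psd_nonneg: "psd n B \<Longrightarrow> 0 \<le> qform n B x x"
  by (auto simp: psd_def)

lemma qform_add_left: "qform n B (\<lambda>i. x i + y i) z = qform n B x z + qform n B y z"
  by (simp add: qform_def algebra_simps sum.distrib)

lemma qform_scale_left: "qform n B (\<lambda>i. a * x i) z = a * qform n B x z"
  by (simp add: qform_def sum_distrib_left mult_ac)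

lemma qform_sym: "psd n B \<Longrightarrow> qform n B x y = qform n B y x"
  unfolding qform_def
  by (subst sum.swap) (auto intro!: sum.cong simp: psd_sym mult_ac)

lemma qform_expand:
  assumes "psd n B"
  shows "qform n B (\<lambda>i. x i + a * y i) (\<lambda>i. x i + a * y i)
    = qform n B x x + 2 * a * qform n B x y + a\<^sup>2 * qform n B y y"
proof -
  have *: "qform n B z (\<lambda>i. x i + a * y i) = qform n B x z + a * qform n B y z" for z
    by (subst qform_sym[OF assms]) (simp add: qform_add_left qform_scale_left)
  show ?thesis
    by (simp add: * qform_add_left qform_scale_left qform_sym[OF assms, of y x] power2_eq_square algebra_simps)
qed

text \<open>Extracts first-order optimality conditions from perturbations of size \<open>t\<close>,
  in place of derivatives.\<close>

lemma nonneg_quadratic_imp: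
  fixes a b :: real
  assumes "\<And>t. 0 < t \<Longrightarrow> t \<le> 1 \<Longrightarrow> 0 \<le> 2 * t * a + t\<^sup>2 * b"
  shows "0 \<le> a"
proof (rule ccontr)
  assume "\<not> 0 \<le> a"
  then have a: "a < 0" by simp
  \<comment> \<open>Small enough that t * b \<le> - a, so that 2 * a + t * b \<le> a < 0.\<close>
  define t where "t = min 1 (- a / (\<bar>b\<bar> + 1))"
  have "0 < - a / (\<bar>b\<bar> + 1)" using a by (intro divide_pos_pos) auto
  then have t: "0 < t" "t \<le> 1" by (auto simp: t_def)
  have "t \<le> - a / (\<bar>b\<bar> + 1)" by (simp add: t_def)
  then have ta: "t * (\<bar>b\<bar> + 1) \<le> - a" by (subst (asm) pos_le_divide_eq) auto
  have "t * b \<le> t * (\<bar>b\<bar> + 1)" using t by (intro mult_left_mono) auto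
  then have "2 * a + t * b < 0" using ta a by linarith
  then have "t * (2 * a + t * b) < 0" using t by (simp add: mult_pos_neg)
  then show False using assms[of t] t by (simp add: power2_eq_square algebra_simps)
qed

lemma psd_Cauchy_Schwarz:
  assumes B: "psd n B"
  shows "(qform n B x y)\<^sup>2 \<le> qform n B x x * qform n B y y"
proof -
  let ?a = "qform n B x x" and ?b = "qform n B x y" and ?c = "qform n B y y"
  have q: "0 \<le> ?a + 2 * s * ?b + s\<^sup>2 * ?c" for s
    using psd_nonneg[OF B] qform_expand[OF B] by metis
  show ?thesis
  proof (cases "?c = 0")
    case True
    have "?b = 0"
    proof (rule ccontr)
      assume "?b \<noteq> 0"
      \<comment> \<open>At this \<open>s\<close> the expression in \<open>q\<close> equals
        -1.\<close>
      then show False using q[of "- (?a + 1) / (2 * ?b)"] True by (simp add: field_simps)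
    qed
    then show ?thesis using True by simp
  next
    case False
    then have "0 < ?c" using psd_nonneg[OF B, of y] by simp
    then show ?thesis using q[of "- ?b / ?c"] by (simp add: field_simps power2_eq_square)
  qed
qed

lemma qform_unit:
  assumes "i < n" "j < n"
  shows "qform n B (\<lambda>k. of_bool (k = i)) (\<lambda>k. of_bool (k = j)) = B i j"
proof -
  have "qform n B (\<lambda>k. of_bool (k = i)) (\<lambda>k. of_bool (k = j))
      = (\<Sum>k<n. \<Sum>l<n. if k = i then (if l = j then B k l else 0) else 0)"
    unfolding qform_def by (intro sum.cong) auto
  also have "\<dots> = (\<Sum>k<n. if k = i then B k j else 0)"
    using assms by (intro sum.cong) auto
  also have "\<dots> = B i j" using assms by simp
  finally show ?thesis .
qed

lemma psd_diag_nonneg: "psd n B \<Longrightarrow> i < n \<Longrightarrow> 0 \<le> B i i"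
  using psd_nonneg[of n B "\<lambda>k. of_bool (k = i)"] by (simp add: qform_unit)

text \<open>The form is tested at the sum and the difference of two unit vectors. Bounding the
  diagonal thus bounds all entries, which is the source of compactness below.\<close>

lemma psd_entry_bound:
  assumes B: "psd n B" and ij: "i < n" "j < n"
  shows "\<bar>B i j\<bar> \<le> (B i i + B j j) / 2"
proof -
  have "0 \<le> B i i + 2 * a * B i j + a\<^sup>2 * B j j" for a
    using psd_nonneg[OF B, of "\<lambda>k. of_bool (k = i) + a * of_bool (k = j)"] qform_expand[OF B]
    by (simp add: qform_unit ij)
  from this[of 1] this[of "-1"] show ?thesis by simp
qed

lemma qform_add_mat: "qform n (\<lambda>i j. A i j + c * B i j) x y = qform n A x y + c * qform n B x y"
  by (simp add: qform_def algebra_simps sum.distrib sum_distrib_left)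

lemma psd_add: "psd n A \<Longrightarrow> psd n B \<Longrightarrow> 0 \<le> c \<Longrightarrow> psd n (\<lambda>i j. A i j + c * B i j)"
  unfolding psd_def qform_add_mat by auto

lemma psd_zero: "psd n (\<lambda>i j. 0)"
  by (simp add: psd_def qform_def)

lemma psd_scale: "psd n A \<Longrightarrow> 0 \<le> c \<Longrightarrow> psd n (\<lambda>i j. c * A i j)"
  using psd_add[of n "\<lambda>i j. 0" A c] psd_zero by simp

lemma psd_rank_one: "psd n (\<lambda>i j. x i * x j)"
proof -
  have "qform n (\<lambda>i j. x i * x j) y y = (\<Sum>i<n. x i * y i)\<^sup>2" for y
    by (simp add: qform_def power2_eq_square sum_product mult_ac)
  then show ?thesis by (simp add: psd_def)
qed

text \<open>For each coordinate \<open>l\<close> the contribution is the form of \<open>B\<close> at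
  the vector of all \<open>l\<close>-th coordinates.\<close>

lemma psd_hadamard_gram:
  assumes "psd n B"
  shows "0 \<le> (\<Sum>i<n. \<Sum>j<n. B i j * ip m (v i) (v j))"
proof -
  have "(\<Sum>i<n. \<Sum>j<n. B i j * ip m (v i) (v j)) = (\<Sum>i<n. \<Sum>j<n. \<Sum>l<m. v i l * v j l * B i j)"
    by (simp add: ip_def sum_distrib_left mult_ac)
  also have "\<dots> = (\<Sum>i<n. \<Sum>l<m. \<Sum>j<n. v i l * v j l * B i j)"
    by (intro sum.cong refl sum.swap)
  also have "\<dots> = (\<Sum>l<m. qform n B (\<lambda>i. v i l) (\<lambda>i. v i l))"
    unfolding qform_def by (rule sum.swap)
  also have "\<dots> \<ge> 0" using psd_nonneg[OF assms] by (intro sum_nonneg) auto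
  finally show ?thesis .
qed

text \<open>Cholesky factorization by induction: the Schur complement \<open>C\<close> of the last
  diagonal entry is psd, and Gram vectors for \<open>C\<close> are extended by the coordinate
  \<open>B i n / sqrt b\<close>.\<close>

lemma psd_imp_gram:
  "psd n B \<Longrightarrow> \<exists>v. \<forall>i<n. \<forall>j<n. ip n (v i) (v j) = B i j"
proof (induction n arbitrary: B)
  case (Suc n)
  define b where "b = B n n"
  have b0: "0 \<le> b" unfolding b_def by (rule psd_diag_nonneg[OF Suc.prems]) simp
  \<comment> \<open>If \<open>b\<close> is 0, the last column vanishes by Cauchy-Schwarz, so the
    convention that division by 0 gives 0 yields correct values below.\<close>
  have zero: "B i n = 0" if "i < Suc n" "b = 0" for i
    using psd_Cauchy_Schwarz[OF Suc.prems, of "\<lambda>k. of_bool (k = i)" "\<lambda>k. of_bool (k = n)"] that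
    by (simp add: qform_unit b_def)
  define C where "C = (\<lambda>i j. B i j - B i n * B j n / b)"
  have qS: "qform (Suc n) B x y = qform n B x y + x n * (\<Sum>j<n. y j * B n j)
      + y n * (\<Sum>i<n. x i * B i n) + x n * y n * b" for x y
    by (simp add: qform_def b_def sum.distrib sum_distrib_left algebra_simps)
  have "psd n C"
    unfolding psd_def
  proof (intro conjI allI impI)
    show "C i j = C j i" if "i < n" "j < n" for i j
      using psd_sym[OF Suc.prems, of i j] that by (simp add: C_def)
    show "0 \<le> qform n C x x" for x
    proof -
      define r where "r = (\<Sum>i<n. x i * B i n)"
      have r': "(\<Sum>j<n. x j * B n j) = r"
        unfolding r_def using psd_sym[OF Suc.prems] by (intro sum.cong) auto
      have rr: "(\<Sum>i<n. \<Sum>j<n. x i * x j * (B i n * B j n)) = r * r"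
        unfolding r_def sum_product by (simp add: mult_ac)
      have "qform n C x x = qform n B x x - r * r / b"
        unfolding C_def qform_def rr[symmetric]
        by (simp add: right_diff_distrib sum_subtractf sum_divide_distrib)
      \<comment> \<open>The last coordinate \<open>- r / b\<close> minimizes the form of
        \<open>B\<close> over that coordinate, so the form of \<open>C\<close> takes only values of
        the form of \<open>B\<close>.\<close>
      moreover have "qform (Suc n) B (x(n := - r / b)) (x(n := - r / b)) = qform n B x x - r * r / b"
      proof -
        have "qform n B (x(n := - r / b)) (x(n := - r / b)) = qform n B x x"
          unfolding qform_def by (intro sum.cong) auto
        moreover have "(\<Sum>j<n. (x(n := - r / b)) j * B n j) = r"
          unfolding r'[symmetric] by (intro sum.cong) auto
        moreover have "(\<Sum>i<n. (x(n := - r / b)) i * B i n) = r"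
          unfolding r_def by (intro sum.cong) auto
        ultimately show ?thesis unfolding qS by (cases "b = 0") (auto simp: field_simps)
      qed
      ultimately show ?thesis using psd_nonneg[OF Suc.prems] by metis
    qed
  qed
  from Suc.IH[OF this] obtain v where v: "\<And>i j. i < n \<Longrightarrow> j < n \<Longrightarrow> ip n (v i) (v j) = C i j"
    by blast
  define u where "u i = (if i < n then (v i)(n := B i n / sqrt b) else (\<lambda>_. 0)(n := sqrt b))" for i
  have u1: "ip (Suc n) (u i) (u j) = B i j" if "i < n" "j < n" for i j
  proof -
    have "(\<Sum>l<n. u i l * u j l) = ip n (v i) (v j)"
      unfolding ip_def u_def using that by (intro sum.cong) auto
    then show ?thesis
      using v[OF that] that b0 zero[of i] by (simp add: ip_def u_def C_def)
  qed
  have u2: "ip (Suc n) (u i) (u n) = B i n" "ip (Suc n) (u n) (u i) = B i n" if "i < n" for i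
    using that b0 zero[of i] by (simp_all add: ip_def u_def)
  have u3: "ip (Suc n) (u n) (u n) = b"
    using b0 by (simp add: ip_def u_def)
  have "ip (Suc n) (u i) (u j) = B i j" if "i < Suc n" "j < Suc n" for i j
    using that u1[of i j] u2[of i] u2[of j] u3 psd_sym[OF Suc.prems, of i j]
    by (auto simp: less_Suc_eq b_def)
  then show ?case by blast
qed simp

section \<open>Compactness and attained extrema\<close>

definition trunc :: "nat \<Rightarrow> (nat \<Rightarrow> nat \<Rightarrow> real) \<Rightarrow> nat \<Rightarrow> nat \<Rightarrow> real" where
  "trunc n B i j = (if i < n \<and> j < n then B i j else 0)"

lemma psd_trunc: "psd n B \<Longrightarrow> psd n (trunc n B)"
  unfolding psd_def qform_def by (simp add: trunc_def)

lemma continuous_on_entry: "continuous_on S (\<lambda>B :: nat \<Rightarrow> nat \<Rightarrow> real. B i j)"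
  by (intro continuous_on_subset[OF continuous_on_product_then_coordinatewise[OF
        continuous_on_product_coordinates]]) simp

text \<open>Tychonoff's theorem, applied once for each index.\<close>

lemma compact_box: "compact {B :: nat \<Rightarrow> nat \<Rightarrow> real. \<forall>i j. B i j \<in> {-L..L}}"
proof -
  have pi: "compact (Pi\<^sub>E UNIV (\<lambda>_::nat. K))" if "compact K" for K :: "'b::topological_space set"
    using compactin_PiE[of "\<lambda>_. euclidean" UNIV "\<lambda>_::nat. K"] that
    by (simp add: euclidean_product_topology)
  have "{B :: nat \<Rightarrow> nat \<Rightarrow> real. \<forall>i j. B i j \<in> {-L..L}} = Pi\<^sub>E UNIV (\<lambda>_. Pi\<^sub>E UNIV (\<lambda>_. {-L..L}))"
    by (auto simp: PiE_def Pi_def)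
  then show ?thesis using pi[OF pi[OF compact_Icc]] by simp
qed

lemma closed_psd: "closed {B. psd n B}"
  unfolding psd_def qform_def
  by (intro closed_Collect_conj closed_Collect_all closed_Collect_imp open_Collect_const
      closed_Collect_eq closed_Collect_le continuous_intros continuous_on_entry)

text \<open>Matrices are functions on all pairs of naturals, so entries outside the leading
  \<open>n\<close> by \<open>n\<close> block are unconstrained and \<open>Q\<close> need not be
  compact. Truncation sets them to 0, leaves \<open>F\<close> unchanged, and lands in the compact
  set \<open>S\<close>, whose maximum is therefore global.\<close>

lemma psd_attains_sup:
  fixes F :: "(nat \<Rightarrow> nat \<Rightarrow> real) \<Rightarrow> real"
  assumes F: "continuous_on UNIV F" and Q: "closed Q" "Q \<noteq> {}"
    and psd: "\<And>B. B \<in> Q \<Longrightarrow> psd n B" and bd: "\<And>B i. B \<in> Q \<Longrightarrow> i < n \<Longrightarrow> B i i \<le> L"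
    and tr: "\<And>B. B \<in> Q \<Longrightarrow> trunc n B \<in> Q" "\<And>B. B \<in> Q \<Longrightarrow> F (trunc n B) = F B"
  shows "\<exists>B\<in>Q. \<forall>C\<in>Q. F C \<le> F B"
proof -
  define S where "S = {B. \<forall>i j. B i j \<in> {-\<bar>L\<bar>..\<bar>L\<bar>}} \<inter> Q"
  have "compact S" unfolding S_def using compact_box Q(1) by (rule compact_Int_closed)
  have SI: "trunc n B \<in> S" if "B \<in> Q" for B
  proof -
    have "\<bar>trunc n B i j\<bar> \<le> \<bar>L\<bar>" for i j
      using psd_entry_bound[OF psd[OF that], of i j] bd[OF that, of i] bd[OF that, of j]
      by (auto simp: trunc_def)
    then have "trunc n B i j \<in> {-\<bar>L\<bar>..\<bar>L\<bar>}" for i j by (simp add: abs_le_iff minus_le_iff)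
    then show ?thesis using tr(1)[OF that] by (simp add: S_def)
  qed
  have "S \<noteq> {}" using Q(2) SI by blast
  from continuous_attains_sup[OF \<open>compact S\<close> this continuous_on_subset[OF F subset_UNIV]]
  obtain B where "B \<in> S" "\<forall>C\<in>S. F C \<le> F B" by blast
  moreover have "F C \<le> F B" if "C \<in> Q" for C
    using calculation(2) SI[OF that] tr(2)[OF that] by metis
  ultimately show ?thesis unfolding S_def by blast
qed

section \<open>Duality for vector colorings\<close>

text \<open>The three kinds of colorings are treated at once: \<open>up\<close> and \<open>lo\<close> tell for which pairs the
  inner product is bounded above, respectively below, by \<open>- 1 / (k - 1)\<close>.\<close>

definition pat_coloring ::
  "nat \<Rightarrow> (nat \<Rightarrow> nat \<Rightarrow> bool) \<Rightarrow> (nat \<Rightarrow> nat \<Rightarrow> bool) \<Rightarrow> real \<Rightarrow> (nat \<Rightarrow> nat \<Rightarrow> real) \<Rightarrow> bool" where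
  "pat_coloring n up lo k v \<longleftrightarrow> unit_vecs n v \<and>
     (\<forall>i<n. \<forall>j<n. i \<noteq> j \<longrightarrow> (up i j \<longrightarrow> ip n (v i) (v j) \<le> - 1 / (k - 1)) \<and>
        (lo i j \<longrightarrow> - 1 / (k - 1) \<le> ip n (v i) (v j)))"

definition pat_theta :: "nat \<Rightarrow> (nat \<Rightarrow> nat \<Rightarrow> bool) \<Rightarrow> (nat \<Rightarrow> nat \<Rightarrow> bool) \<Rightarrow> real" where
  "pat_theta n up lo = Inf {k. k > 1 \<and> (\<exists>v. pat_coloring n up lo k v)}"

text \<open>Off-diagonal entries are Lagrange multipliers: a positive one must be backed by an upper
  bound on the inner product, a negative one by a lower bound.\<close>

definition pat_dual ::
  "nat \<Rightarrow> (nat \<Rightarrow> nat \<Rightarrow> bool) \<Rightarrow> (nat \<Rightarrow> nat \<Rightarrow> bool) \<Rightarrow> (nat \<Rightarrow> nat \<Rightarrow> real) \<Rightarrow> bool" where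
  "pat_dual n up lo B \<longleftrightarrow> psd n B \<and> trc n B = 1 \<and>
     (\<forall>i j. i < n \<longrightarrow> j < n \<longrightarrow> i \<noteq> j \<longrightarrow> (\<not> up i j \<longrightarrow> B i j \<le> 0) \<and> (\<not> lo i j \<longrightarrow> 0 \<le> B i j))"

lemma entry_sum_split: "entry_sum n B = trc n B + (\<Sum>i<n. \<Sum>j<n. if i = j then 0 else B i j)"
proof -
  have "(\<Sum>j<n. B i j) = B i i + (\<Sum>j<n. if i = j then 0 else B i j)" if "i < n" for i
  proof -
    have "(\<Sum>j<n. B i j) = (\<Sum>j<n. (if i = j then B i j else 0) + (if i = j then 0 else B i j))"
      by (intro sum.cong) auto
    then show ?thesis using that by (simp add: sum.distrib)
  qed
  then show ?thesis by (simp add: entry_sum_def trc_def sum.distrib)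
qed

text \<open>Pairing \<open>B\<close> with the Gram matrix of the coloring gives a nonnegative
  number, and the sign conditions bound it by 1 - c * (entry_sum n B - 1) with c = 1 / (k -
  1).\<close>

lemma pat_dual_weak:
  assumes B: "pat_dual n up lo B" and v: "pat_coloring n up lo k v" and k: "1 < k"
  shows "entry_sum n B \<le> k"
proof -
  define c where "c = 1 / (k - 1)"
  have c: "0 < c" using k by (simp add: c_def)
  have "B i j * ip n (v i) (v j) \<le> (if i = j then B i j else - c * B i j)" if ij: "i < n" "j < n" for i j
  proof (cases "i = j")
    case True
    then show ?thesis using v ij by (simp add: pat_coloring_def unit_vecs_def)
  next
    case False
    have d: "\<not> up i j \<Longrightarrow> B i j \<le> 0" "\<not> lo i j \<Longrightarrow> 0 \<le> B i j"
      using B ij False by (auto simp: pat_dual_def)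
    have p: "up i j \<Longrightarrow> ip n (v i) (v j) \<le> - c" "lo i j \<Longrightarrow> - c \<le> ip n (v i) (v j)"
      using v ij False by (auto simp: pat_coloring_def c_def)
    have "B i j * ip n (v i) (v j) \<le> B i j * (- c)"
    proof (cases "0 \<le> B i j")
      case True
      show ?thesis
      proof (cases "up i j")
        case up: True
        show ?thesis by (rule mult_left_mono[OF p(1)[OF up] True])
      next
        case False
        then show ?thesis using d(1) True by simp
      qed
    next
      case False
      then have "lo i j" using d(2) by blast
      then show ?thesis using p(2) False by (intro mult_left_mono_neg) auto
    qed
    then show ?thesis using False by (simp add: mult.commute)
  qed
  then have "(\<Sum>i<n. \<Sum>j<n. B i j * ip n (v i) (v j)) \<le> (\<Sum>i<n. \<Sum>j<n. if i = j then B i j else - c * B i j)"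
    by (intro sum_mono) auto
  also have "\<dots> = entry_sum n (\<lambda>i j. if i = j then B i j else - c * B i j)" by (simp add: entry_sum_def)
  also have "\<dots> = trc n B - c * (entry_sum n B - trc n B)"
    unfolding entry_sum_split[of n "\<lambda>i j. if i = j then B i j else - c * B i j"] entry_sum_split[of n B]
    by (simp add: trc_def sum_distrib_left sum_negf[symmetric] if_distrib cong: if_cong)
  finally have "0 \<le> trc n B - c * (entry_sum n B - trc n B)"
    using psd_hadamard_gram[of n B n v] B by (simp add: pat_dual_def)
  then have "c * (entry_sum n B - 1) \<le> 1" using B by (simp add: pat_dual_def)
  then show ?thesis using k by (simp add: c_def field_simps)
qed

lemma continuous_on_entry_sum: "continuous_on S (entry_sum n)"
  unfolding entry_sum_def by (intro continuous_intros continuous_on_entry)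

lemma pat_dual_max:
  assumes n: "0 < n"
  shows "\<exists>B. pat_dual n up lo B \<and> 1 \<le> entry_sum n B \<and> (\<forall>C. pat_dual n up lo C \<longrightarrow> entry_sum n C \<le> entry_sum n B)"
proof -
  \<comment> \<open>A single 1 in the corner is feasible with value 1; it shows that the feasible
    set is nonempty and that the maximum is at least 1.\<close>
  define e :: "nat \<Rightarrow> nat \<Rightarrow> real" where "e = (\<lambda>i j. of_bool (i = 0) * of_bool (j = 0))"
  have sum0: "(\<Sum>i<n. of_bool (i = 0) :: real) = 1" using n by (simp add: of_bool_def)
  have "trc n e = 1" unfolding trc_def e_def sum0[symmetric] by (intro sum.cong) auto
  moreover have "psd n e" unfolding e_def by (rule psd_rank_one)
  ultimately have e: "pat_dual n up lo e" by (auto simp: pat_dual_def e_def)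
  have te: "entry_sum n e = 1" 
    using sum_product[of "\<lambda>i. of_bool (i = 0) :: real" "{..<n}" "\<lambda>j. of_bool (j = 0)" "{..<n}"]
    unfolding entry_sum_def e_def sum0 by linarith
  have "\<exists>B\<in>{B. pat_dual n up lo B}. \<forall>C\<in>{B. pat_dual n up lo B}. entry_sum n C \<le> entry_sum n B"
  proof (rule psd_attains_sup[where L = 1 and F = "entry_sum n" and Q = "{B. pat_dual n up lo B}"])
    show "continuous_on UNIV (entry_sum n)" by (rule continuous_on_entry_sum)
    show "closed {B. pat_dual n up lo B}"
      unfolding pat_dual_def trc_def
      by (intro closed_Collect_conj closed_Collect_all closed_Collect_imp open_Collect_const closed_psd
          closed_Collect_eq closed_Collect_le continuous_intros continuous_on_entry)
    show "{B. pat_dual n up lo B} \<noteq> {}" using e by blast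
    fix B assume "B \<in> {B. pat_dual n up lo B}"
    then have B: "pat_dual n up lo B" by simp
    then show "psd n B" by (simp add: pat_dual_def)
    show "B i i \<le> 1" if "i < n" for i
      using member_le_sum[of i "{..<n}" "\<lambda>i. B i i"] psd_diag_nonneg[OF \<open>psd n B\<close>] that B
      by (auto simp: pat_dual_def trc_def)
    show "trunc n B \<in> {B. pat_dual n up lo B}"
      using B psd_trunc unfolding pat_dual_def trc_def by (auto simp: trunc_def)
    show "entry_sum n (trunc n B) = entry_sum n B" by (simp add: entry_sum_def trunc_def)
  qed
  then obtain B where B: "pat_dual n up lo B" "\<And>C. pat_dual n up lo C \<Longrightarrow> entry_sum n C \<le> entry_sum n B"
    by blast
  then show ?thesis using B(2)[OF e] te by auto
qed

text \<open>The signed distance of \<open>t\<close> to the half line, line or point that the constraints allow. The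
  inequality below replaces the derivative of its square.\<close>

definition resid :: "bool \<Rightarrow> bool \<Rightarrow> real \<Rightarrow> real" where
  "resid u l t = (if u then max t 0 else 0) + (if l then min t 0 else 0)"

lemma resid_sq_add: "(resid u l (t + h))\<^sup>2 \<le> (resid u l t)\<^sup>2 + 2 * resid u l t * h + h\<^sup>2"
proof -
  have *: "(max (t + h) 0)\<^sup>2 \<le> (max t 0)\<^sup>2 + 2 * max t 0 * h + h\<^sup>2" for t h :: real
  proof (cases "0 \<le> t")
    case True
    have "(max (t + h) 0)\<^sup>2 \<le> (t + h)\<^sup>2" by (simp add: max_def)
    then show ?thesis using True by (simp add: power2_eq_square algebra_simps)
  next
    case False
    then have "\<bar>max (t + h) 0\<bar> \<le> \<bar>h\<bar>" by (auto simp: max_def)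
    then have "(max (t + h) 0)\<^sup>2 \<le> h\<^sup>2" by (simp only: abs_le_square_iff)
    then show ?thesis using False by simp
  qed
  have mm: "min t 0 = - max (- t) 0" for t :: real by (simp add: max_def min_def)
  have s: "max t 0 + min t 0 = t" for t :: real by (simp add: max_def min_def)
  show ?thesis
  proof (cases "u \<and> l")
    case True
    then show ?thesis by (simp add: resid_def s) (simp add: power2_eq_square algebra_simps)
  next
    case False
    then show ?thesis using *[of t h] *[of "- t" "- h"]
      by (cases u) (auto simp: resid_def mm)
  qed
qed

lemma resid_mult: "resid u l t * t = (resid u l t)\<^sup>2"
  by (cases u; cases l) (auto simp: resid_def power2_eq_square max_def min_def)

text \<open>The sublevel set of \<open>F\<close> through the zero matrix has bounded diagonals, so
  the compactness argument applies to \<open>- F\<close> on it.\<close>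

lemma psd_penalty_minimizer:
  assumes F: "continuous_on UNIV F" and tr: "\<And>B. F (trunc n B) = F B"
    and coer: "\<And>B i. psd n B \<Longrightarrow> i < n \<Longrightarrow> (B i i - 1)\<^sup>2 \<le> F B"
  shows "\<exists>M. psd n M \<and> (\<forall>N. psd n N \<longrightarrow> F M \<le> (F N :: real))"
proof -
  define f0 where "f0 = F (\<lambda>i j. 0)"
  have "\<exists>B\<in>{B. psd n B \<and> F B \<le> f0}. \<forall>C\<in>{B. psd n B \<and> F B \<le> f0}. - F C \<le> - F B"
  proof (rule psd_attains_sup[where L = "f0 + 2"])
    show "continuous_on UNIV (\<lambda>B. - F B)" using F by (intro continuous_intros)
    show "closed {B. psd n B \<and> F B \<le> f0}"
      by (intro closed_Collect_conj closed_psd closed_Collect_le F continuous_intros)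
    show "{B. psd n B \<and> F B \<le> f0} \<noteq> {}" using psd_zero by (auto simp: f0_def)
    fix B assume B: "B \<in> {B. psd n B \<and> F B \<le> f0}"
    then show "psd n B" by simp
    show "B i i \<le> f0 + 2" if "i < n" for i
    proof -
      have "(B i i - 1)\<^sup>2 \<le> f0" using coer[of B i] B that by force
      \<comment> \<open>This square says (x - 1)^2 \<ge> x - 5/4 for x = B i i, whence x \<le> f0 +
        5/4.\<close>
      moreover have "0 \<le> (B i i - 3 / 2)\<^sup>2" by simp
      ultimately show ?thesis by (simp add: power2_eq_square algebra_simps)
    qed
    show "trunc n B \<in> {B. psd n B \<and> F B \<le> f0}" using B psd_trunc tr by simp
    show "- F (trunc n B) = - F B" by (simp add: tr)
  qed
  then obtain M where M: "psd n M" "F M \<le> f0" "\<And>C. psd n C \<Longrightarrow> F C \<le> f0 \<Longrightarrow> F M \<le> F C"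
    by auto
  then have "F M \<le> F N" if "psd n N" for N
    using that by (cases "F N \<le> f0") auto
  then show ?thesis using M(1) by blast
qed

lemma psd_zero_trace:
  assumes "psd n B" "trc n B = 0" "i < n" "j < n"
  shows "B i j = 0"
proof -
  have "\<forall>i\<in>{..<n}. B i i = 0"
    using assms(2) psd_diag_nonneg[OF assms(1)] unfolding trc_def
    by (subst (asm) sum_nonneg_eq_0_iff) auto
  then show ?thesis using psd_entry_bound[OF assms(1,3,4)] assms(3,4) by simp
qed

text \<open>Homogeneous form of the dual bound: divide by the trace. A psd matrix of trace 0
  vanishes, which settles the remaining case.\<close>

lemma pat_dual_entry_sum_le:
  assumes "psd n R" and "\<And>i j. i < n \<Longrightarrow> j < n \<Longrightarrow> i \<noteq> j \<Longrightarrow> (\<not> up i j \<longrightarrow> R i j \<le> 0) \<and> (\<not> lo i j \<longrightarrow> 0 \<le> R i j)"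
    and k: "\<And>C. pat_dual n up lo C \<Longrightarrow> entry_sum n C \<le> k"
  shows "entry_sum n R \<le> k * trc n R"
proof (cases "trc n R = 0")
  case True
  have "entry_sum n R = 0"
    unfolding entry_sum_def using psd_zero_trace[OF assms(1) True] by (intro sum.neutral ballI) auto
  then show ?thesis using True by simp
next
  case False
  have "0 \<le> trc n R"
    unfolding trc_def using psd_diag_nonneg[OF assms(1)] by (intro sum_nonneg) auto
  then have pos: "0 < trc n R" using False by simp
  have "pat_dual n up lo (\<lambda>i j. (1 / trc n R) * R i j)"
    unfolding pat_dual_def
  proof (intro conjI allI impI)
    show "psd n (\<lambda>i j. (1 / trc n R) * R i j)"
      using assms(1) pos by (intro psd_scale) auto
    show "trc n (\<lambda>i j. (1 / trc n R) * R i j) = 1"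
      using pos by (simp add: trc_def flip: sum_divide_distrib)
  qed (use assms(2) pos in \<open>auto simp: divide_nonpos_pos\<close>)
  from k[OF this] have "entry_sum n R / trc n R \<le> k"
    by (simp add: entry_sum_def flip: sum_divide_distrib)
  then show ?thesis using pos by (simp add: pos_divide_le_eq)
qed

text \<open>Strong duality by least squares instead of separation. Optimality of \<open>M\<close> in
  rank-one directions makes the residual psd, and in the direction of \<open>- M\<close> gives a
  nonpositive pairing of residual and \<open>M\<close>. Expanding this pairing and inserting the
  dual bound leaves F M \<le> 0, so \<open>M\<close> satisfies all constraints and its Gram vectors
  form the coloring.\<close>

lemma pat_coloring_exists:
  assumes sym: "symp up" "symp lo"
    and max: "\<And>C. pat_dual n up lo C \<Longrightarrow> entry_sum n C \<le> k" and k: "1 < k"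
  shows "\<exists>v. pat_coloring n up lo k v"
proof -
  define c where "c = 1 / (k - 1)"
  have c: "0 < c" using k by (simp add: c_def)
  \<comment> \<open>\<open>F\<close> is the squared distance to the constraints. At a minimizer \<open>M\<close> over the psd cone the residual
    \<open>R M\<close> is itself a dual matrix, of value exceeding \<open>k\<close> unless it vanishes.\<close>
  define R where "R M i j = (if i = j then M i j - 1 else resid (up i j) (lo i j) (M i j + c))"
    for M :: "nat \<Rightarrow> nat \<Rightarrow> real" and i j
  define F where "F M = (\<Sum>i<n. \<Sum>j<n. (R M i j)\<^sup>2)" for M
  define dot where "dot A B = (\<Sum>i<n. \<Sum>j<n. A i j * B i j)" for A B :: "nat \<Rightarrow> nat \<Rightarrow> real"
  have R_cont: "continuous_on UNIV (\<lambda>M. R M i j)" for i j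
    unfolding R_def resid_def
    by (cases "i = j"; cases "up i j"; cases "lo i j"; simp; intro continuous_intros continuous_on_entry)
  have "\<exists>M. psd n M \<and> (\<forall>N. psd n N \<longrightarrow> F M \<le> F N)"
  proof (rule psd_penalty_minimizer)
    show "continuous_on UNIV F"
      unfolding F_def by (intro continuous_intros R_cont)
    show "F (trunc n B) = F B" for B
      unfolding F_def R_def by (intro sum.cong) (auto simp: trunc_def)
    show "(B i i - 1)\<^sup>2 \<le> F B" if "i < n" for B i
    proof -
      have "(B i i - 1)\<^sup>2 = (R B i i)\<^sup>2" by (simp add: R_def)
      also have "\<dots> \<le> (\<Sum>j<n. (R B i j)\<^sup>2)" using that by (intro member_le_sum) auto
      also have "\<dots> \<le> F B" unfolding F_def
        using that by (intro member_le_sum[of i "{..<n}" "\<lambda>i. \<Sum>j<n. (R B i j)\<^sup>2"] sum_nonneg) auto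
      finally show ?thesis .
    qed
  qed
  then obtain M where M: "psd n M" "\<And>N. psd n N \<Longrightarrow> F M \<le> F N" by blast
  have R_add: "(R (\<lambda>i j. M i j + t * N i j) i j)\<^sup>2
      \<le> (R M i j)\<^sup>2 + 2 * t * (R M i j * N i j) + t\<^sup>2 * (N i j * N i j)" for t N i j
    using resid_sq_add[of "up i j" "lo i j" "M i j + c" "t * N i j"]
    by (simp add: R_def power2_eq_square algebra_simps)
  have first_order: "0 \<le> dot (R M) N"
    if N: "\<And>t. 0 < t \<Longrightarrow> t \<le> 1 \<Longrightarrow> psd n (\<lambda>i j. M i j + t * N i j)" for N
  proof (rule nonneg_quadratic_imp)
    fix t :: real assume t: "0 < t" "t \<le> 1"
    have "F M \<le> F (\<lambda>i j. M i j + t * N i j)" by (rule M(2)[OF N[OF t]])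
    also have "\<dots> \<le> (\<Sum>i<n. \<Sum>j<n. (R M i j)\<^sup>2 + 2 * t * (R M i j * N i j) + t\<^sup>2 * (N i j * N i j))"
      unfolding F_def by (intro sum_mono R_add)
    also have "\<dots> = F M + 2 * t * dot (R M) N + t\<^sup>2 * dot N N"
      unfolding F_def dot_def by (simp add: sum.distrib sum_distrib_left)
    finally show "0 \<le> 2 * t * dot (R M) N + t\<^sup>2 * dot N N" by simp
  qed
  have R_psd: "psd n (R M)"
    unfolding psd_def
  proof (intro conjI allI impI)
    show "R M i j = R M j i" if "i < n" "j < n" for i j
      using psd_sym[OF M(1) that] sym[THEN sympD] by (auto simp: R_def resid_def)
    show "0 \<le> qform n (R M) x x" for x
    proof -
      have "0 \<le> dot (R M) (\<lambda>i j. x i * x j)"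
        by (rule first_order) (intro psd_add M(1) psd_rank_one, simp)
      then show ?thesis by (simp add: dot_def qform_def mult_ac)
    qed
  qed
  have "0 \<le> dot (R M) (\<lambda>i j. - M i j)"
  proof (rule first_order)
    fix t :: real assume "0 < t" "t \<le> 1"
    then have "psd n (\<lambda>i j. (1 - t) * M i j)" using M(1) by (intro psd_scale) auto
    then show "psd n (\<lambda>i j. M i j + t * - M i j)" by (simp add: algebra_simps)
  qed
  then have "dot (R M) M \<le> 0" by (simp add: dot_def sum_negf)
  moreover have "dot (R M) M = F M + trc n (R M) - c * (entry_sum n (R M) - trc n (R M))"
  proof -
    \<comment> \<open>Off the diagonal \<open>M\<close> is written as \<open>(M + c) - c\<close>, on
      it as \<open>(M - 1) + 1\<close>; the residual times the bracket is the squared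
      residual.\<close>
    have "R M i j * M i j = (R M i j)\<^sup>2 + (if i = j then R M i j else - c * R M i j)" for i j
      using resid_mult[of "up i j" "lo i j" "M i j + c"]
      by (auto simp: R_def power2_eq_square algebra_simps)
    then have "dot (R M) M = F M + entry_sum n (\<lambda>i j. if i = j then R M i j else - c * R M i j)"
      unfolding dot_def F_def entry_sum_def by (simp add: sum.distrib)
    moreover have "entry_sum n (\<lambda>i j. if i = j then R M i j else - c * R M i j)
        = trc n (R M) - c * (entry_sum n (R M) - trc n (R M))"
      unfolding entry_sum_split[of n "\<lambda>i j. if i = j then R M i j else - c * R M i j"] entry_sum_split[of n "R M"]
      by (simp add: trc_def sum_distrib_left sum_negf[symmetric] if_distrib cong: if_cong)
    ultimately show ?thesis by simp
  qed
  ultimately have "F M + trc n (R M) \<le> c * (entry_sum n (R M) - trc n (R M))" by simp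
  also have "\<dots> \<le> c * (k * trc n (R M) - trc n (R M))"
  proof -
    have "entry_sum n (R M) \<le> k * trc n (R M)"
    proof (rule pat_dual_entry_sum_le[OF R_psd _ max])
      show "(\<not> up i j \<longrightarrow> R M i j \<le> 0) \<and> (\<not> lo i j \<longrightarrow> 0 \<le> R M i j)" if "i \<noteq> j" for i j
        using that by (auto simp: R_def resid_def)
    qed
    then show ?thesis using c by (intro mult_left_mono) auto
  qed
  also have "\<dots> = c * (k - 1) * trc n (R M)" by (simp add: algebra_simps)
  also have "\<dots> = trc n (R M)" using k by (simp add: c_def)
  finally have "F M \<le> 0" by simp
  moreover have "0 \<le> F M" by (auto simp: F_def intro!: sum_nonneg)
  ultimately have "F M = 0" by simp
  then have R0: "R M i j = 0" if "i < n" "j < n" for i j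
    using that unfolding F_def by (simp add: sum_nonneg_eq_0_iff sum_nonneg)
  obtain v where v: "\<And>i j. i < n \<Longrightarrow> j < n \<Longrightarrow> ip n (v i) (v j) = M i j"
    using psd_imp_gram[OF M(1)] by blast
  have "pat_coloring n up lo k v"
    unfolding pat_coloring_def unit_vecs_def
  proof (intro conjI allI impI)
    show "ip n (v i) (v i) = 1" if "i < n" for i
      using R0[of i i] v that by (simp add: R_def)
    fix i j assume ij: "i < n" "j < n" "i \<noteq> j"
    have r: "resid (up i j) (lo i j) (M i j + c) = 0" using R0[of i j] ij by (simp add: R_def)
    have ck: "- 1 / (k - 1) = - c" by (simp add: c_def)
    show "ip n (v i) (v j) \<le> - 1 / (k - 1)" if "up i j"
      using r that v ij unfolding ck by (auto simp: resid_def max_def min_def split: if_splits)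
    show "- 1 / (k - 1) \<le> ip n (v i) (v j)" if "lo i j"
      using r that v ij unfolding ck by (auto simp: resid_def max_def min_def split: if_splits)
  qed
  then show ?thesis by blast
qed

text \<open>Only values \<open>k\<close> strictly above the dual maximum are shown to admit
  colorings: that maximum may be 1, whereas colorings require k > 1. The infimum is
  unaffected.\<close>

theorem pat_theta_duality:
  assumes n: "0 < n" and sym: "symp up" "symp lo"
  shows "\<exists>B. pat_dual n up lo B \<and> entry_sum n B = pat_theta n up lo \<and> 1 \<le> entry_sum n B \<and>
    (\<forall>C. pat_dual n up lo C \<longrightarrow> entry_sum n C \<le> entry_sum n B)"
proof -
  obtain B where B: "pat_dual n up lo B" "1 \<le> entry_sum n B"
      "\<And>C. pat_dual n up lo C \<Longrightarrow> entry_sum n C \<le> entry_sum n B"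
    using pat_dual_max[OF n] by blast
  define S where "S = {k. k > 1 \<and> (\<exists>v. pat_coloring n up lo k v)}"
  have mem: "k \<in> S" if "entry_sum n B < k" for k
    unfolding S_def using pat_coloring_exists[OF sym, of n k] B(2,3) that by force
  have bdd: "bdd_below S" by (rule bdd_belowI[of _ 1]) (auto simp: S_def)
  have "Inf S \<le> entry_sum n B"
  proof (rule field_le_epsilon)
    show "Inf S \<le> entry_sum n B + e" if "0 < e" for e
      using mem[of "entry_sum n B + e"] bdd that by (intro cInf_lower) auto
  qed
  moreover have "entry_sum n B \<le> Inf S"
  proof (rule cInf_greatest)
    show "S \<noteq> {}" using mem[of "entry_sum n B + 1"] by auto
    show "entry_sum n B \<le> k" if "k \<in> S" for k
      using that pat_dual_weak[OF B(1)] by (auto simp: S_def)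
  qed
  ultimately have "entry_sum n B = pat_theta n up lo" unfolding pat_theta_def S_def by simp
  then show ?thesis using B by blast
qed

text \<open>Optimality of \<open>B\<close> is tested against the congruent matrices obtained by rescaling row and column \<open>i\<close>.\<close>

lemma pat_dual_row_sum:
  assumes B: "pat_dual n up lo B" and max: "\<And>C. pat_dual n up lo C \<Longrightarrow> entry_sum n C \<le> entry_sum n B"
    and i: "i < n"
  shows "(\<Sum>j<n. B i j) = entry_sum n B * B i i"
proof -
  have psd: "psd n B" and tr: "trc n B = 1" using B by (auto simp: pat_dual_def)
  \<comment> \<open>Row and column \<open>i\<close> are multiplied by \<open>1 + t\<close>; for
    \<bar>t\<bar> \<le> 1 the factor is nonnegative, so the sign conditions survive.\<close>
  have key: "entry_sum n B + 2 * t * (\<Sum>j<n. B i j) + t\<^sup>2 * B i i \<le> entry_sum n B * (1 + (2 * t + t\<^sup>2) * B i i)"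
    if t: "\<bar>t\<bar> \<le> 1" for t
  proof -
    define d where "d = (\<lambda>j. 1 + t * of_bool (j = i))"
    define C where "C j k = d j * d k * B j k" for j k
    have d: "0 \<le> d j" for j using t by (simp add: d_def abs_le_iff)
    have "psd n C"
      unfolding psd_def
    proof (intro conjI allI impI)
      show "C j k = C k j" if "j < n" "k < n" for j k
        using psd_sym[OF psd that] by (simp add: C_def)
      have "qform n C x x = qform n B (\<lambda>j. d j * x j) (\<lambda>j. d j * x j)" for x
        by (simp add: qform_def C_def mult_ac)
      then show "0 \<le> qform n C x x" for x using psd_nonneg[OF psd] by simp
    qed
    then have "entry_sum n C \<le> entry_sum n B * trc n C"
    proof (rule pat_dual_entry_sum_le[OF _ _ max])
      show "(\<not> up j k \<longrightarrow> C j k \<le> 0) \<and> (\<not> lo j k \<longrightarrow> 0 \<le> C j k)" if "j < n" "k < n" "j \<noteq> k" for j k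
        using B that d[of j] d[of k] unfolding pat_dual_def C_def
        by (auto intro: mult_nonneg_nonpos mult_nonneg_nonneg)
    qed
    moreover have "entry_sum n C = qform n B d d"
      by (simp add: entry_sum_def C_def qform_def)
    moreover have "qform n B d d = entry_sum n B + 2 * t * (\<Sum>j<n. B i j) + t\<^sup>2 * B i i"
    proof -
      have "qform n B (\<lambda>_. 1) (\<lambda>j. of_bool (j = i)) = (\<Sum>j<n. B i j)"
      proof -
        have "qform n B (\<lambda>j. of_bool (j = i)) (\<lambda>_. 1) = (\<Sum>k<n. if k = i then \<Sum>j<n. B i j else 0)"
          unfolding qform_def by (intro sum.cong) auto
        then show ?thesis using i by (simp add: qform_sym[OF psd, of "\<lambda>_. 1"])
      qed
      moreover have "qform n B (\<lambda>_. 1) (\<lambda>_. 1) = entry_sum n B" by (simp add: qform_def entry_sum_def)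
      ultimately show ?thesis
        unfolding d_def qform_expand[OF psd] by (simp add: qform_unit i)
    qed
    moreover have "trc n C = 1 + (2 * t + t\<^sup>2) * B i i"
    proof -
      have "C j j = B j j + (if j = i then (2 * t + t\<^sup>2) * B i i else 0)" for j
        by (simp add: C_def d_def power2_eq_square algebra_simps)
      then have "trc n C = trc n B + (2 * t + t\<^sup>2) * B i i"
        unfolding trc_def using i by (simp add: sum.distrib)
      then show ?thesis using tr by simp
    qed
    ultimately show ?thesis by simp
  qed
  define a where "a = entry_sum n B * B i i - (\<Sum>j<n. B i j)"
  define b where "b = entry_sum n B * B i i - B i i"
  have q: "0 \<le> 2 * t * a + t\<^sup>2 * b" if "\<bar>t\<bar> \<le> 1" for t
    using key[OF that] by (simp add: a_def b_def algebra_simps)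
  have "0 \<le> a" by (rule nonneg_quadratic_imp[of a b]) (use q in auto)
  \<comment> \<open>Perturbing with \<open>- t\<close> gives the opposite inequality, hence
    equality.\<close>
  moreover have "0 \<le> - a"
  proof (rule nonneg_quadratic_imp[of "- a" b])
    show "0 \<le> 2 * t * - a + t\<^sup>2 * b" if "0 < t" "t \<le> 1" for t
      using q[of "- t"] that by simp
  qed
  ultimately show ?thesis by (simp add: a_def)
qed

text \<open>Take \<open>w i = \<theta> * B i i\<close> for an optimal \<open>B\<close>. Deleting the
  rows and columns outside \<open>T\<close> leaves a matrix that obeys the sign conditions of every
  pattern agreeing on \<open>T\<close>. Its entry sum is at least (\<Sum>i\<in>T. w i)^2 / \<theta>
  by Cauchy-Schwarz and at most (\<Sum>i\<in>T. w i) / \<theta> times the new value by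
  duality.\<close>

theorem pat_theta_certificate:
  assumes n: "0 < n" and sym: "symp up" "symp lo"
  shows "1 \<le> pat_theta n up lo \<and> (\<exists>w. (\<forall>i. 0 \<le> w i \<and> w i \<le> 1) \<and> (\<Sum>i<n. w i) = pat_theta n up lo \<and>
    (\<forall>T up' lo'. T \<subseteq> {..<n} \<longrightarrow> symp up' \<longrightarrow> symp lo' \<longrightarrow>
      (\<forall>i\<in>T. \<forall>j\<in>T. i \<noteq> j \<longrightarrow> up' i j = up i j \<and> lo' i j = lo i j) \<longrightarrow>
      (\<Sum>i\<in>T. w i) \<le> pat_theta n up' lo'))"
proof -
  obtain B where B: "pat_dual n up lo B" "entry_sum n B = pat_theta n up lo" "1 \<le> entry_sum n B"
      "\<And>C. pat_dual n up lo C \<Longrightarrow> entry_sum n C \<le> entry_sum n B"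
    using pat_theta_duality[OF n sym] by blast
  have psd: "psd n B" and tr: "trc n B = 1" using B by (auto simp: pat_dual_def)
  define \<theta> where "\<theta> = entry_sum n B"
  have \<theta>: "1 \<le> \<theta>" using B by (simp add: \<theta>_def)
  define w where "w i = (if i < n then \<theta> * B i i else 0)" for i
  define ind where "ind T = (\<lambda>i::nat. of_bool (i \<in> T) :: real)" for T
  have w0: "0 \<le> w i" for i using psd_diag_nonneg[OF psd] \<theta> by (simp add: w_def)
  have cs: "(\<Sum>i\<in>T. w i)\<^sup>2 \<le> \<theta> * qform n B (ind T) (ind T)" if "T \<subseteq> {..<n}" for T
  proof -
    have "qform n B (ind T) (\<lambda>_. 1) = (\<Sum>i<n. ind T i * (\<Sum>j<n. B i j))"
      by (simp add: qform_def sum_distrib_left)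
    also have "\<dots> = (\<Sum>i<n. ind T i * w i)"
      using pat_dual_row_sum[OF B(1,4)] by (intro sum.cong) (auto simp: w_def \<theta>_def)
    also have "\<dots> = (\<Sum>i\<in>T. w i)"
      using that by (intro sum.mono_neutral_cong_right) (auto simp: ind_def)
    finally have "qform n B (ind T) (\<lambda>_. 1) = (\<Sum>i\<in>T. w i)" .
    moreover have "qform n B (\<lambda>_. 1) (\<lambda>_. 1) = \<theta>" by (simp add: qform_def entry_sum_def \<theta>_def)
    ultimately show ?thesis
      using psd_Cauchy_Schwarz[OF psd, of "ind T" "\<lambda>_. 1"] by (simp add: mult.commute)
  qed
  \<comment> \<open>For the singleton \<open>T\<close> the bound \<open>cs\<close> reads (w i)^2
    \<le> w i.\<close>
  have w1: "w i \<le> 1" for i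
  proof (cases "i < n \<and> w i \<noteq> 0")
    case True
    then have "qform n B (ind {i}) (ind {i}) = B i i" by (simp add: ind_def qform_unit)
    then have "w i * w i \<le> w i * 1"
      using cs[of "{i}"] True by (simp add: w_def power2_eq_square)
    then show ?thesis using True w0[of i] by (simp add: mult_le_cancel_left)
  qed (auto simp: w_def)
  have "(\<Sum>i<n. w i) = \<theta>"
    using tr by (simp add: w_def trc_def flip: sum_distrib_left)
  moreover have "(\<Sum>i\<in>T. w i) \<le> pat_theta n up' lo'"
    if T: "T \<subseteq> {..<n}" and sym': "symp up'" "symp lo'"
      and agree: "\<forall>i\<in>T. \<forall>j\<in>T. i \<noteq> j \<longrightarrow> up' i j = up i j \<and> lo' i j = lo i j" for T up' lo'
  proof -
    obtain B' where B': "entry_sum n B' = pat_theta n up' lo'" "1 \<le> entry_sum n B'"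
        "\<And>C. pat_dual n up' lo' C \<Longrightarrow> entry_sum n C \<le> entry_sum n B'"
      using pat_theta_duality[OF n sym'] by blast
    define C where "C i j = ind T i * ind T j * B i j" for i j
    have qC: "qform n C x x = qform n B (\<lambda>i. ind T i * x i) (\<lambda>i. ind T i * x i)" for x
      by (simp add: qform_def C_def mult_ac)
    have "psd n C"
      unfolding psd_def qC using psd_sym[OF psd] psd_nonneg[OF psd] by (auto simp: C_def)
    then have "entry_sum n C \<le> entry_sum n B' * trc n C"
    proof (rule pat_dual_entry_sum_le[OF _ _ B'(3)])
      show "(\<not> up' i j \<longrightarrow> C i j \<le> 0) \<and> (\<not> lo' i j \<longrightarrow> 0 \<le> C i j)" if "i < n" "j < n" "i \<noteq> j" for i j
        using B(1) that agree unfolding pat_dual_def C_def ind_def by auto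
    qed
    moreover have "entry_sum n C = qform n B (ind T) (ind T)"
      by (simp add: entry_sum_def C_def qform_def)
    ultimately have "\<theta> * qform n B (ind T) (ind T) \<le> entry_sum n B' * (\<theta> * trc n C)"
      using \<theta> by (simp add: mult.left_commute)
    moreover have "\<theta> * trc n C = (\<Sum>i\<in>T. w i)"
    proof -
      have "\<theta> * trc n C = (\<Sum>i<n. ind T i * w i)"
        unfolding trc_def sum_distrib_left by (intro sum.cong) (auto simp: C_def ind_def w_def)
      also have "\<dots> = (\<Sum>i\<in>T. w i)"
        using T by (intro sum.mono_neutral_cong_right) (auto simp: ind_def)
      finally show ?thesis .
    qed
    ultimately have le: "(\<Sum>i\<in>T. w i) * (\<Sum>i\<in>T. w i) \<le> entry_sum n B' * (\<Sum>i\<in>T. w i)"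
      using cs[OF T] by (simp add: power2_eq_square)
    show ?thesis
    proof (cases "(\<Sum>i\<in>T. w i) = 0")
      case False
      then have "0 < (\<Sum>i\<in>T. w i)" using w0 by (simp add: sum_nonneg less_le)
      then show ?thesis using le B'(1) by simp
    qed (use B' in auto)
  qed
  ultimately show ?thesis using w0 w1 \<theta> B(2) unfolding \<theta>_def by metis
qed

section \<open>Concentration under vertex exposure\<close>

text \<open>Vertex exposure: the \<open>i\<close>-th coordinate of a random graph consists of the edges from \<open>i\<close> to smaller
  vertices.\<close>

definition back_edges :: "nat \<Rightarrow> nat set set" where
  "back_edges i = (\<lambda>j. {j, i}) ` {..<i}"

lemma Union_back_edges: "(\<Union>i<n. back_edges i) = all_pairs n"
proof
  show "(\<Union>i<n. back_edges i) \<subseteq> all_pairs n"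
    by (fastforce simp: back_edges_def all_pairs_def)
  show "all_pairs n \<subseteq> (\<Union>i<n. back_edges i)"
  proof
    fix e assume "e \<in> all_pairs n"
    then obtain i j where ij: "e = {i, j}" "i < n" "j < n" "i \<noteq> j" by (auto simp: all_pairs_def)
    then consider "i < j" | "j < i" by linarith
    then show "e \<in> (\<Union>i<n. back_edges i)"
      using ij by cases (auto simp: back_edges_def insert_commute)
  qed
qed

lemma back_edges_disjoint: "i \<noteq> j \<Longrightarrow> back_edges i \<inter> back_edges j = {}"
  by (auto simp: back_edges_def doubleton_eq_iff)

text \<open>A potential edge lies in the block of its larger endpoint.\<close>

lemma back_edges_agree:
  assumes "x \<inter> back_edges i = y \<inter> back_edges i" "x \<inter> back_edges j = y \<inter> back_edges j" "i \<noteq> j"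
  shows "{i, j} \<in> x \<longleftrightarrow> {i, j} \<in> y"
proof -
  consider "i < j" | "j < i" using assms(3) by linarith
  then have "{i, j} \<in> back_edges i \<or> {i, j} \<in> back_edges j"
    by cases (auto simp: back_edges_def insert_commute)
  then show ?thesis using assms(1,2) by blast
qed

text \<open>Equality on the edges of the complement is encoded by imposing both bounds there; in the
  rigid case the lower bound is imposed on all pairs.\<close>

lemma theta_pat:
  "theta n E = pat_theta n (\<lambda>i j. {i, j} \<in> compl_graph n E) (\<lambda>i j. {i, j} \<in> compl_graph n E)"
  "theta_half n E = pat_theta n (\<lambda>i j. {i, j} \<in> compl_graph n E) (\<lambda>i j. False)"
  "theta_2 n E = pat_theta n (\<lambda>i j. {i, j} \<in> compl_graph n E) (\<lambda>i j. True)"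
proof -
  have "strict_vector_coloring n C k v = pat_coloring n (\<lambda>i j. {i, j} \<in> C) (\<lambda>i j. {i, j} \<in> C) k v"
    "vector_coloring n C k v = pat_coloring n (\<lambda>i j. {i, j} \<in> C) (\<lambda>i j. False) k v"
    "rigid_vector_coloring n C k v = pat_coloring n (\<lambda>i j. {i, j} \<in> C) (\<lambda>i j. True) k v" for C k v
    unfolding strict_vector_coloring_def vector_coloring_def rigid_vector_coloring_def pat_coloring_def
    by (auto simp: antisym_conv intro: antisym) (metis order_refl)+
  then show
    "theta n E = pat_theta n (\<lambda>i j. {i, j} \<in> compl_graph n E) (\<lambda>i j. {i, j} \<in> compl_graph n E)"
    "theta_half n E = pat_theta n (\<lambda>i j. {i, j} \<in> compl_graph n E) (\<lambda>i j. False)"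
    "theta_2 n E = pat_theta n (\<lambda>i j. {i, j} \<in> compl_graph n E) (\<lambda>i j. True)"
    by (simp_all add: theta_def theta_bar_def theta_half_def theta_bar_half_def theta_2_def
        theta_bar_2_def pat_theta_def)
qed

lemma pat_theta_vertex_certificate:
  assumes n: "0 < n" and sym: "\<And>E. symp (up E)" "\<And>E. symp (lo E)"
    and agree: "\<And>x y i j. i \<noteq> j \<Longrightarrow> x \<inter> back_edges i = y \<inter> back_edges i \<Longrightarrow>
      x \<inter> back_edges j = y \<inter> back_edges j \<Longrightarrow> up y i j = up x i j \<and> lo y i j = lo x i j"
    and f: "\<And>E. f E = pat_theta n (up E) (lo E)"
  shows "1 \<le> f x" "\<exists>w. (\<forall>i. 0 \<le> w i \<and> w i \<le> 1) \<and> (\<Sum>i<n. w i) \<le> f x \<and>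
       (\<forall>y. f x - (\<Sum>i<n. w i * of_bool (x \<inter> back_edges i \<noteq> y \<inter> back_edges i)) \<le> f y)"
proof -
  note c = pat_theta_certificate[OF n sym(1)[of x] sym(2)[of x], folded f]
  show "1 \<le> f x" using c by blast
  obtain w where w: "\<And>i. 0 \<le> w i \<and> w i \<le> 1" "(\<Sum>i<n. w i) = f x"
    "\<And>T up' lo'. T \<subseteq> {..<n} \<Longrightarrow> symp up' \<Longrightarrow> symp lo' \<Longrightarrow>
      (\<forall>i\<in>T. \<forall>j\<in>T. i \<noteq> j \<longrightarrow> up' i j = up x i j \<and> lo' i j = lo x i j) \<Longrightarrow>
      (\<Sum>i\<in>T. w i) \<le> pat_theta n up' lo'"
    using c by (elim conjE exE) blast
  have "f x - (\<Sum>i<n. w i * of_bool (x \<inter> back_edges i \<noteq> y \<inter> back_edges i)) \<le> f y" for y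
  proof -
    \<comment> \<open>The vertices with unchanged blocks. Both graphs agree on pairs inside
      \<open>T\<close>, so the weight of \<open>T\<close> bounds the new value from below.\<close>
    define T where "T = {i \<in> {..<n}. x \<inter> back_edges i = y \<inter> back_edges i}"
    have "(\<Sum>i<n. w i * of_bool (x \<inter> back_edges i \<noteq> y \<inter> back_edges i)) + (\<Sum>i\<in>T. w i)
        = (\<Sum>i<n. w i * of_bool (x \<inter> back_edges i \<noteq> y \<inter> back_edges i) + (if i \<in> T then w i else 0))"
      by (simp add: sum.distrib sum.If_cases T_def Int_def)
    also have "\<dots> = (\<Sum>i<n. w i)" by (intro sum.cong) (auto simp: T_def)
    finally have "f x - (\<Sum>i<n. w i * of_bool (x \<inter> back_edges i \<noteq> y \<inter> back_edges i)) = (\<Sum>i\<in>T. w i)"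
      using w(2) by simp
    also have "\<dots> \<le> f y"
      unfolding f[of y]
    proof (intro w(3) sym ballI impI)
      show "up y i j = up x i j \<and> lo y i j = lo x i j" if "i \<in> T" "j \<in> T" "i \<noteq> j" for i j
        using agree[of i j x y] that by (simp add: T_def)
    qed (auto simp: T_def)
    finally show ?thesis .
  qed
  then show "\<exists>w. (\<forall>i. 0 \<le> w i \<and> w i \<le> 1) \<and> (\<Sum>i<n. w i) \<le> f x \<and>
       (\<forall>y. f x - (\<Sum>i<n. w i * of_bool (x \<inter> back_edges i \<noteq> y \<inter> back_edges i)) \<le> f y)"
    using w(1,2) by (intro exI[of _ w]) auto
qed

lemma theta_vertex_certificate:
  assumes n: "0 < n" and f: "f \<in> {theta, theta_half, theta_2}"
  shows "1 \<le> f n x" "\<exists>w. (\<forall>i. 0 \<le> w i \<and> w i \<le> 1) \<and> (\<Sum>i<n. w i) \<le> f n x \<and>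
       (\<forall>y. f n x - (\<Sum>i<n. w i * of_bool (x \<inter> back_edges i \<noteq> y \<inter> back_edges i)) \<le> f n y)"
proof -
  have sym: "symp (\<lambda>i j. {i, j} \<in> compl_graph n E)" for E
    by (auto intro!: sympI simp: insert_commute)
  have sym': "symp (\<lambda>i j. b)" for b by (auto intro: sympI)
  have agree: "({i, j} \<in> compl_graph n y) = ({i, j} \<in> compl_graph n x)"
    if "i \<noteq> j" "x \<inter> back_edges i = y \<inter> back_edges i" "x \<inter> back_edges j = y \<inter> back_edges j" for x y i j
    using back_edges_agree[OF that(2,3,1)] by (simp add: compl_graph_def)
  obtain lo where lo: "\<And>E. symp (lo E)"
    "\<And>x y i j. i \<noteq> j \<Longrightarrow> x \<inter> back_edges i = y \<inter> back_edges i \<Longrightarrow>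
      x \<inter> back_edges j = y \<inter> back_edges j \<Longrightarrow> lo y i j = lo x i j"
    "\<And>E. f n E = pat_theta n (\<lambda>i j. {i, j} \<in> compl_graph n E) (lo E)"
  proof -
    consider "f = theta" | "f = theta_half" | "f = theta_2" using f by blast
    then show ?thesis
    proof cases
      case 1 show ?thesis
        by (rule that[of "\<lambda>E i j. {i, j} \<in> compl_graph n E"]) (use sym agree 1 theta_pat(1) in blast)+
    next
      case 2 show ?thesis by (rule that[of "\<lambda>E i j. False"]) (auto simp: 2 theta_pat(2) sym')
    next
      case 3 show ?thesis by (rule that[of "\<lambda>E i j. True"]) (auto simp: 3 theta_pat(3) sym')
    qed
  qed
  have agree': "({i, j} \<in> compl_graph n y) = ({i, j} \<in> compl_graph n x) \<and> lo y i j = lo x i j"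
    if "i \<noteq> j" "x \<inter> back_edges i = y \<inter> back_edges i" "x \<inter> back_edges j = y \<inter> back_edges j" for x y i j
    using agree[OF that] lo(2)[OF that] by simp
  note V = pat_theta_vertex_certificate[where up = "\<lambda>E i j. {i, j} \<in> compl_graph n E" and lo = lo
      and f = "f n", OF n sym lo(1) _ lo(3)]
  show "1 \<le> f n x"
    by (rule V(1)) (rule agree')
  show "\<exists>w. (\<forall>i. 0 \<le> w i \<and> w i \<le> 1) \<and> (\<Sum>i<n. w i) \<le> f n x \<and>
       (\<forall>y. f n x - (\<Sum>i<n. w i * of_bool (x \<inter> back_edges i \<noteq> y \<inter> back_edges i)) \<le> f n y)"
    by (rule V(2)) (rule agree')
qed

lemma theta_concentration:
  assumes n: "0 < n" and f: "f \<in> {theta, theta_half, theta_2}" and p: "0 < p" "p < 1"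
    and ab: "0 < a" "a \<le> b"
  shows "gnp_prob n p (\<lambda>E. f n E \<le> a) * gnp_prob n p (\<lambda>E. b \<le> f n E) \<le> exp (- (b - a)\<^sup>2 / (4 * b))"
proof -
  have "gnp_prob n p Q = (\<Sum>E | E \<subseteq> (\<Union>i<n. back_edges i) \<and> Q E. bern p (\<Union>i<n. back_edges i) E)" for Q
    by (simp add: gnp_prob_def bern_def Union_back_edges)
  moreover have "finite (back_edges i)" for i by (simp add: back_edges_def)
  ultimately show ?thesis
    using certificate_concentration[where f = "f n" and N = n, OF p _ back_edges_disjoint
        theta_vertex_certificate(2)[OF n f] ab]
    by simp
qed

section \<open>Tail bounds around a median\<close>

lemma gnp_prob_eq_0: "(\<And>E. \<not> Q E) \<Longrightarrow> gnp_prob n p Q = 0"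
  by (simp add: gnp_prob_def)

theorem theorem1:
  shows "\<exists>n0::nat. n0 > 0 \<and> (\<forall>n \<ge> n0. \<forall>p::real. 0 < p \<and> p \<le> 0.99 \<longrightarrow>
    (\<forall>f \<in> {theta, theta_half, theta_2}. \<forall>m. is_median n p f m \<longrightarrow>
      (\<forall>\<xi>. \<xi> \<ge> max 10 (sqrt m) \<longrightarrow>
          gnp_prob n p (\<lambda>E. f n E \<ge> m + \<xi>) \<le> 30 * exp (- \<xi>\<^sup>2 / (5 * m + 10 * \<xi>))) \<and>
      (\<forall>\<xi>. \<xi> > 10 \<longrightarrow>
          gnp_prob n p (\<lambda>E. f n E \<le> m - \<xi>) \<le> 3 * exp (- \<xi>\<^sup>2 / (10 * m)))))"
\<comment> \<open>The estimates are non-asymptotic, so \<open>n0 = 1\<close> works.\<close>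
proof (intro exI[of _ "1::nat"] conjI allI impI ballI)
  fix n :: nat and p :: real and f m
  assume "1 \<le> n" and p': "0 < p \<and> p \<le> 0.99" and f: "f \<in> {theta, theta_half, theta_2}"
    and med: "is_median n p f m"
  then have n: "0 < n" and p: "0 < p" "p < 1" by auto
  have lower: "1/2 \<le> gnp_prob n p (\<lambda>E. f n E \<le> m)" and upper: "1/2 \<le> gnp_prob n p (\<lambda>E. m \<le> f n E)"
    using med by (auto simp: is_median_def)
  have f1: "1 \<le> f n E" for E by (rule theta_vertex_certificate(1)[OF n f])
  have m: "1 \<le> m"
  proof (rule ccontr)
    assume "\<not> 1 \<le> m"
    then have "\<not> f n E \<le> m" for E using f1[of E] by linarith
    then show False using lower gnp_prob_eq_0[of "\<lambda>E. f n E \<le> m"] by simp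
  qed
  \<comment> \<open>Dividing by the median probability costs a factor 2, which the constants 30 and
    3 absorb.\<close>
  have half: "y \<le> 2 * z" if "1/2 \<le> x" "x * y \<le> z" "0 \<le> z" for x y z :: real
  proof (cases "0 \<le> y")
    case True
    then have "1/2 * y \<le> x * y" using that by (intro mult_right_mono)
    then show ?thesis using that by simp
  qed (use that in auto)
  show "gnp_prob n p (\<lambda>E. f n E \<ge> m + \<xi>) \<le> 30 * exp (- \<xi>\<^sup>2 / (5 * m + 10 * \<xi>))"
    if "\<xi> \<ge> max 10 (sqrt m)" for \<xi>
  proof -
    have xi: "10 \<le> \<xi>" using that by simp
    have "gnp_prob n p (\<lambda>E. m + \<xi> \<le> f n E) \<le> 2 * exp (- (m + \<xi> - m)\<^sup>2 / (4 * (m + \<xi>)))"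
      using theta_concentration[OF n f p, of m "m + \<xi>"] m xi by (intro half[OF lower]) auto
    also have "\<dots> \<le> 30 * exp (- \<xi>\<^sup>2 / (5 * m + 10 * \<xi>))"
    proof (intro mult_mono)
      have "\<xi>\<^sup>2 / (5 * m + 10 * \<xi>) \<le> \<xi>\<^sup>2 / (4 * (m + \<xi>))"
        using m xi by (intro divide_left_mono mult_pos_pos) auto
      then show "exp (- (m + \<xi> - m)\<^sup>2 / (4 * (m + \<xi>))) \<le> exp (- \<xi>\<^sup>2 / (5 * m + 10 * \<xi>))" by simp
    qed auto
    finally show ?thesis .
  qed
  show "gnp_prob n p (\<lambda>E. f n E \<le> m - \<xi>) \<le> 3 * exp (- \<xi>\<^sup>2 / (10 * m))" if xi: "\<xi> > 10" for \<xi>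
  \<comment> \<open>Below 1 the event is empty; otherwise \<open>a = m - \<xi>\<close> is positive,
    as the concentration bound requires.\<close>
  proof (cases "1 \<le> m - \<xi>")
    case False
    then have "\<not> f n E \<le> m - \<xi>" for E using f1[of E] by linarith
    then show ?thesis using gnp_prob_eq_0[of "\<lambda>E. f n E \<le> m - \<xi>"] by simp
  next
    case True
    have "gnp_prob n p (\<lambda>E. f n E \<le> m - \<xi>) \<le> 2 * exp (- (m - (m - \<xi>))\<^sup>2 / (4 * m))"
      using theta_concentration[OF n f p, of "m - \<xi>" m] True xi
      by (intro half[OF upper]) (auto simp: mult.commute)
    also have "\<dots> \<le> 3 * exp (- \<xi>\<^sup>2 / (10 * m))"
    proof (intro mult_mono)
      have "\<xi>\<^sup>2 / (10 * m) \<le> \<xi>\<^sup>2 / (4 * m)"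
        using m by (intro divide_left_mono mult_pos_pos) auto
      then show "exp (- (m - (m - \<xi>))\<^sup>2 / (4 * m)) \<le> exp (- \<xi>\<^sup>2 / (10 * m))" by simp
    qed auto
    finally show ?thesis .
  qed
qed simp

end
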